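(* Suppose that $\mathbb{E}(\|Z\|^2) < \infty$ and $\mu := \mathbb{E} Z \neq \mathbf{0}$. Then, as $n\to\infty$, \[ \mathbb{E} L_n = 2\|\mu\| n + \left( \frac{\sigma^2_{\mu_\perp}}{\|\mu\|} + o(1) \right)\log n. \]
   Context: Let $Z, Z_1, Z_2, \ldots$ be i.i.d. random variables in $\mathbb{R}^2$, and let $S_0 := \mathbf{0}$ (the origin) and $S_n := \sum_{k=1}^n Z_k$ for $n \ge 1$. Let $L_n$ be the perimeter length of the convex hull of $\{S_0, \ldots, S_n\}$. (If the hull is a line segment, its perimeter length is twice the length of the segment; in general, $L_n = \int_0^{2\pi} \max_{0\le k\le n} (S_k\cdot \mathbf{e}_\theta)\,d\theta$ with $\mathbf{e}_\theta = (\cos\theta,\sin\theta)$.) Here $\|\cdot\|$ is the Euclidean norm. With $\hat\mu := \mu/\|\mu\|$, define $\sigma^2 := \mathbb{E}(\|Z-\mu\|^2)$, $\sigma^2_\mu := \mathbb{E}[((Z-\mu)\cdot\hat\mu)^2]$, and $\sigma^2_{\mu_\perp} := \sigma^2 - \sigma^2_\mu$. *)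

theory Defs
  imports "HOL-Probability.Probability" "HOL-Library.Landau_Symbols"
begin

(* Perimeter length of a planar polytope (in particular of the convex hull of a finite set).
   For a polygon with nonempty interior it is the total length of its edges.  A segment has itself
   as its only edge, but as a degenerate polygon it is traversed twice, so its perimeter is twice
   its length.  A single point has perimeter 0. *)
definition perimeter :: "(real^2) set \<Rightarrow> real" where
  "perimeter K =
     (if aff_dim K = 2 then (\<Sum>F | F edge_of K. diameter F) else 2 * diameter K)"

lemma perimeter_closed_segment: "perimeter (closed_segment a b) = 2 * dist a b"
proof -
  have "aff_dim (closed_segment a b) \<le> 1"
    using aff_dim_le_card[of "{a, b}"] card_insert_le_m1[of 2 "{b}" a]
    by (simp add: segment_convex_hull aff_dim_convex_hull)
  moreover have "diameter (closed_segment a b) = dist a b"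
  proof (rule antisym)
    show "diameter (closed_segment a b) \<le> dist a b"
    proof (rule diameter_le)
      fix x y assume x: "x \<in> closed_segment a b" and y: "y \<in> closed_segment a b"
      have "closed_segment a b \<subseteq> cball x (dist a b)"
        using dist_in_closed_segment[OF x] by (intro closed_segment_subset) auto
      then show "norm (x - y) \<le> dist a b"
        using y by (auto simp: dist_norm)
    qed simp
    show "dist a b \<le> diameter (closed_segment a b)"
      using diameter_bounded_bound[of "closed_segment a b" a b]
        bounded_closed_segment[of a b] by simp
  qed
  ultimately show ?thesis
    by (simp add: perimeter_def)
qed

(* The increments are Z 1, Z 2, ...; the variable Z 0 is not used by the walk. *)
definition walk :: "(nat \<Rightarrow> 'a \<Rightarrow> real^2) \<Rightarrow> nat \<Rightarrow> 'a \<Rightarrow> real^2" where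
  "walk Z n \<omega> = (\<Sum>k=1..n. Z k \<omega>)"

definition hull_perimeter :: "(nat \<Rightarrow> 'a \<Rightarrow> real^2) \<Rightarrow> nat \<Rightarrow> 'a \<Rightarrow> real" where
  "hull_perimeter Z n \<omega> = perimeter (convex hull ((\<lambda>k. walk Z k \<omega>) ` {0..n}))"

definition mean :: "'a measure \<Rightarrow> ('a \<Rightarrow> real^2) \<Rightarrow> real^2" where
  "mean M X = (LINT \<omega>|M. X \<omega>)"

definition mean_dir :: "'a measure \<Rightarrow> ('a \<Rightarrow> real^2) \<Rightarrow> real^2" where
  "mean_dir M X = mean M X /\<^sub>R norm (mean M X)"

definition total_var :: "'a measure \<Rightarrow> ('a \<Rightarrow> real^2) \<Rightarrow> real" where
  "total_var M X = (LINT \<omega>|M. (norm (X \<omega> - mean M X))\<^sup>2)"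

definition par_var :: "'a measure \<Rightarrow> ('a \<Rightarrow> real^2) \<Rightarrow> real" where
  "par_var M X = (LINT \<omega>|M. ((X \<omega> - mean M X) \<bullet> mean_dir M X)\<^sup>2)"

definition perp_var :: "'a measure \<Rightarrow> ('a \<Rightarrow> real^2) \<Rightarrow> real" where
  "perp_var M X = total_var M X - par_var M X"

end

theory Submission
  imports Defs
begin

text \<open>
  Two facts carry the proof. The first is the Spitzer--Widom formula
  \<open>E L\<^sub>n = (\<Sum>k=1..n. 2 * E \<parallel>S\<^sub>k\<parallel> / k)\<close>, which reduces the expected perimeter to expected
  distances from the origin. The second is the expansion
  \<open>E \<parallel>S\<^sub>k\<parallel> = k * \<parallel>\<mu>\<parallel> + v / (2 * \<parallel>\<mu>\<parallel>) + o(1)\<close>, where \<open>v\<close> is the variance perpendicular to the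
  drift. Inserting the second into the first, the leading terms add up to \<open>2 * \<parallel>\<mu>\<parallel> * n\<close>, and the
  constant, summed against \<open>1 / k\<close>, gives \<open>v / \<parallel>\<mu>\<parallel>\<close> times a harmonic sum, hence the logarithm
  (\<open>log_average_tendsto\<close>).

  The formula for \<open>E L\<^sub>n\<close> (\<open>expectation_hull_perimeter\<close>) combines a geometric and a combinatorial
  argument. Geometrically, the perimeter is proportional to the width averaged over all directions
  (\<open>perimeter_eq_mean_width\<close>): in a fixed direction, almost every line that meets a polygon crosses
  exactly two of its edges (\<open>level_line_meets_two_edges\<close>), so the shadows of the edges have total
  length twice the width, and averaging over directions turns the shadow of an edge into a multiple of
  its length. The proportionality constant cancels, since the same constant turns
  \<open>\<bar>S\<^sub>k \<bullet> e\<bar>\<close>, averaged over \<open>e\<close>, back into \<open>\<parallel>S\<^sub>k\<parallel>\<close>. Combinatorially, the width of the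
  hull in direction \<open>e\<close> is the maximum minus the minimum of the one-dimensional walk
  \<open>S\<^sub>k \<bullet> e\<close>, and the expected maximum of such a walk is given by the formula of Kac and Spitzer
  (\<open>expectation_running_max\<close>), a consequence of the invariance of the law of the increments under
  permutations.

  For the expansion of \<open>E \<parallel>S\<^sub>k\<parallel>\<close> (\<open>expectation_norm_walk\<close>), let \<open>u\<close> be the direction of the
  drift. Since \<open>E (S\<^sub>k \<bullet> u) = k * \<parallel>\<mu>\<parallel>\<close>, what matters is the difference \<open>\<parallel>S\<^sub>k\<parallel> - S\<^sub>k \<bullet> u\<close>, which is the
  squared perpendicular part of \<open>S\<^sub>k\<close> divided by \<open>\<parallel>S\<^sub>k\<parallel> + S\<^sub>k \<bullet> u\<close>. The numerator has expectation
  \<open>k * v\<close>, and the denominator is close to \<open>2 * k * \<parallel>\<mu>\<parallel>\<close> unless the fluctuation \<open>S\<^sub>k - k * \<mu>\<close> is of order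
  \<open>k\<close>. Such large fluctuations have vanishing probability, and they contribute nothing in the limit
  because \<open>\<parallel>S\<^sub>k - k * \<mu>\<parallel>\<^sup>2 / k\<close> is uniformly integrable (\<open>partial_sum_square_uniformly_integrable\<close>); this
  is where finiteness of the second moment enters.
\<close>

section \<open>Perimeter and mean width of polygons\<close>

text \<open>In the plane, the level lines of \<open>e\<close> have the direction of \<open>e\<close> turned by a right angle.\<close>

lemma planar_level_line:
  fixes e r x :: "real^2"
  assumes "e \<noteq> 0" "x \<bullet> e = r \<bullet> e"
  shows "\<exists>s. x = r + s *\<^sub>R vector [- e $ 2, e $ 1]"
proof -
  let ?d = "vector [- e $ 2, e $ 1] :: real^2"
  have nz: "(e $ 1)\<^sup>2 + (e $ 2)\<^sup>2 \<noteq> 0"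
    using assms(1) by (auto simp: vec_eq_iff forall_2 sum_power2_eq_zero_iff)
  define y where "y = x - r"
  have y: "y $ 1 * e $ 1 + y $ 2 * e $ 2 = 0"
    using assms(2) by (simp add: y_def inner_vec_def sum_2 algebra_simps)
  define s where "s = (y $ 2 * e $ 1 - y $ 1 * e $ 2) / ((e $ 1)\<^sup>2 + (e $ 2)\<^sup>2)"
  have "y $ 1 * ((e $ 1)\<^sup>2 + (e $ 2)\<^sup>2) = - (y $ 2 * e $ 1 - y $ 1 * e $ 2) * e $ 2"
    using y by algebra
  moreover have "y $ 2 * ((e $ 1)\<^sup>2 + (e $ 2)\<^sup>2) = (y $ 2 * e $ 1 - y $ 1 * e $ 2) * e $ 1"
    using y by algebra
  ultimately have "y $ 1 = - s * e $ 2 \<and> y $ 2 = s * e $ 1"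
    using nz by (simp add: s_def field_simps)
  then have "y = s *\<^sub>R ?d"
    by (simp add: vec_eq_iff forall_2)
  then show ?thesis
    by (intro exI[of _ s]) (simp add: y_def algebra_simps)
qed

lemma edge_of_polytope_segment:
  fixes K :: "'a::euclidean_space set"
  assumes "polytope K" "F edge_of K"
  obtains a b where "F = closed_segment a b"
proof -
  have "polytope F" and dim: "aff_dim F = 1"
    using assms face_of_polytope_polytope unfolding edge_of_def by auto
  then have "F \<noteq> {}" "compact F" "convex F" "collinear F"
    by (auto simp: polytope_imp_compact polytope_imp_convex collinear_aff_dim)
  then show thesis
    using compact_convex_collinear_segment that by metis
qed

text \<open>Moving from an interior point towards a point of a convex set stays in the interior until the end
  point, so it suffices to move towards whichever of \<open>x\<close> and \<open>y\<close> lies beyond the level \<open>t\<close>.\<close>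

lemma convex_level_interior_point:
  fixes K :: "'a::euclidean_space set"
  assumes "convex K" "interior K \<noteq> {}" "x \<in> K" "y \<in> K" "x \<bullet> e < t" "t < y \<bullet> e"
  obtains r where "r \<in> interior K" "r \<bullet> e = t"
proof -
  obtain z where z: "z \<in> interior K" using assms by auto
  have step: "\<exists>r \<in> interior K. r \<bullet> e = t"
    if w: "w \<in> K" and s: "(z \<bullet> e < t \<and> t < w \<bullet> e) \<or> (w \<bullet> e < t \<and> t < z \<bullet> e)" for w
  proof -
    define s where "s = (t - z \<bullet> e) / (w \<bullet> e - z \<bullet> e)"
    have s01: "0 < s" "s < 1" using s by (auto simp: s_def field_simps)
    let ?r = "(1 - s) *\<^sub>R z + s *\<^sub>R w"
    have "?r \<in> open_segment z w"
      using s01 s by (auto simp: in_segment)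
    then have "?r \<in> interior K"
      using in_interior_closure_convex_segment[of K z w] assms(1) z w closure_subset by blast
    moreover have "?r \<bullet> e = z \<bullet> e + s * (w \<bullet> e - z \<bullet> e)"
      by (simp add: inner_simps algebra_simps)
    then have "?r \<bullet> e = t" using s by (auto simp: s_def)
    ultimately show ?thesis by blast
  qed
  consider "z \<bullet> e = t" | "z \<bullet> e < t" | "t < z \<bullet> e" by linarith
  then show thesis
    by cases (use z that step[of x] step[of y] assms in blast)+
qed

text \<open>The line \<open>{x. x \<bullet> e = t}\<close> passes through an interior point \<open>r\<close>, from which the two rays in the
  line leave the polygon at two boundary points \<open>p\<close> and \<open>q\<close>; by convexity the line has no other
  boundary points. Each of the two lies on an edge, since the boundary is the union of the edges, and on
  only one, since two edges can share nothing but a vertex, and vertices belong to \<open>S\<close>, whose levels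
  are excluded. No edge contains both \<open>p\<close> and \<open>q\<close>, as it would contain the interior point \<open>r\<close>.\<close>

lemma level_line_meets_two_edges:
  fixes S :: "(real^2) set"
  assumes S: "finite S" and dim: "aff_dim (convex hull S) = 2"
    and x: "x \<in> convex hull S" "x \<bullet> e < t" and y: "y \<in> convex hull S" "t < y \<bullet> e"
    and t: "t \<notin> (\<lambda>x. x \<bullet> e) ` S"
  shows "card {F. F edge_of (convex hull S) \<and> t \<in> (\<lambda>x. x \<bullet> e) ` F} = 2"
proof -
  define K where "K = convex hull S"
  have poly: "polytope K" using S by (auto simp: K_def polytope_def)
  have K: "convex K" "compact K" "closed K" "bounded K"
    using poly polytope_imp_convex polytope_imp_compact polytope_imp_bounded compact_imp_closed
    by auto
  have e0: "e \<noteq> 0" using x y by auto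
  have dimK: "aff_dim K = int (DIM(real^2))" using dim by (simp add: K_def)
  have int: "rel_interior K = interior K" using interior_rel_interior[OF dimK] .
  have "K \<noteq> {}" using x by (auto simp: K_def)
  then have intne: "interior K \<noteq> {}"
    using int rel_interior_eq_empty K by metis
  have fr: "frontier K = \<Union> {F. F edge_of K}"
  proof -
    have "frontier K = \<Union> {F. F facet_of K}"
      using rel_frontier_of_polyhedron[OF polytope_imp_polyhedron[OF poly]]
        rel_frontier_nonempty_interior[OF intne] by simp
    moreover have "F facet_of K \<longleftrightarrow> F edge_of K" for F
      using dimK by (auto simp: facet_of_def edge_of_def)
    ultimately show ?thesis by simp
  qed
  have frK: "frontier K \<subseteq> K" "frontier K \<inter> interior K = {}"
    using K by (auto simp: frontier_def)
  obtain r where r: "r \<in> interior K" "r \<bullet> e = t"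
    using convex_level_interior_point[OF K(1) intne, of x y e t] x y by (auto simp: K_def)
  define d :: "real^2" where "d = vector [- e $ 2, e $ 1]"
  have d0: "d \<noteq> 0" using e0 by (auto simp: d_def vec_eq_iff forall_2)
  have de: "d \<bullet> e = 0" by (simp add: d_def inner_vec_def sum_2)
  obtain \<alpha> where \<alpha>: "\<alpha> > 0" "r + \<alpha> *\<^sub>R d \<in> frontier K"
    "\<And>s. 0 \<le> s \<Longrightarrow> s < \<alpha> \<Longrightarrow> r + s *\<^sub>R d \<in> interior K"
    using ray_to_frontier[OF K(4) r(1) d0] by metis
  obtain \<beta> where \<beta>: "\<beta> > 0" "r + \<beta> *\<^sub>R (- d) \<in> frontier K"
    "\<And>s. 0 \<le> s \<Longrightarrow> s < \<beta> \<Longrightarrow> r + s *\<^sub>R (- d) \<in> interior K"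
    using ray_to_frontier[OF K(4) r(1), of "- d"] d0 by (metis neg_equal_0_iff_equal)
  define p where "p = r + \<alpha> *\<^sub>R d"
  define q where "q = r + \<beta> *\<^sub>R (- d)"
  have pe: "p \<bullet> e = t" and qe: "q \<bullet> e = t"
    using r de by (auto simp: p_def q_def inner_simps)
  \<comment> \<open>A boundary point beyond the first boundary point of a ray from an interior point would
    make that first point interior.\<close>
  have first: "s = \<gamma>" if "s > 0" "r + s *\<^sub>R v \<in> frontier K" "\<gamma> > 0" "r + \<gamma> *\<^sub>R v \<in> frontier K"
    "\<And>s. 0 \<le> s \<Longrightarrow> s < \<gamma> \<Longrightarrow> r + s *\<^sub>R v \<in> interior K" "v \<noteq> 0" for s \<gamma> v
  proof (rule ccontr)
    assume "s \<noteq> \<gamma>"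
    with that(1,2,5) frK have "\<gamma> < s" by (meson disjoint_iff linorder_neqE_linordered_idom order_less_imp_le)
    have "r + \<gamma> *\<^sub>R v = (1 - \<gamma> / s) *\<^sub>R r + (\<gamma> / s) *\<^sub>R (r + s *\<^sub>R v)"
      using that(1) by (simp add: algebra_simps)
    moreover have "r \<noteq> r + s *\<^sub>R v" using that by simp
    moreover have "0 < \<gamma> / s" "\<gamma> / s < 1" using that \<open>\<gamma> < s\<close> by auto
    ultimately have "r + \<gamma> *\<^sub>R v \<in> open_segment r (r + s *\<^sub>R v)"
      unfolding in_segment by blast
    then have "r + \<gamma> *\<^sub>R v \<in> interior K"
      using in_interior_closure_convex_segment[OF K(1) r(1)] that(2) frK closure_subset by blast
    then show False using that(4) frK by blast
  qed
  have two: "z = p \<or> z = q" if z: "z \<in> frontier K" "z \<bullet> e = t" for z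
  proof -
    obtain s where s: "z = r + s *\<^sub>R d"
      using planar_level_line[OF e0, of z r] z r by (auto simp: d_def)
    consider "s = 0" | "s > 0" | "- s > 0" by linarith
    then show ?thesis
    proof cases
      case 1
      then show ?thesis using s r z frK by auto
    next
      case 2
      then have "s = \<alpha>" using first[of s d \<alpha>] \<alpha> z s d0 by blast
      then show ?thesis using s by (simp add: p_def)
    next
      case 3
      have "z = r + (- s) *\<^sub>R (- d)" using s by simp
      then have "- s = \<beta>" using first[of "- s" "- d" \<beta>] 3 \<beta> z d0 by (metis neg_equal_0_iff_equal)
      then show ?thesis using s by (auto simp: q_def)
    qed
  qed
  \<comment> \<open>The weight of \<open>q\<close> is proportional to the distance of \<open>p\<close> from \<open>r\<close>.\<close>
  have rseg: "r \<in> open_segment p q"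
  proof -
    have ab: "\<alpha> + \<beta> > 0" using \<alpha> \<beta> by simp
    have pq: "p \<noteq> q"
    proof
      assume "p = q"
      then have "(\<alpha> + \<beta>) *\<^sub>R d = 0" by (simp add: p_def q_def algebra_simps)
      then show False using ab d0 by simp
    qed
    have "(1 - \<alpha> / (\<alpha> + \<beta>)) *\<^sub>R p + (\<alpha> / (\<alpha> + \<beta>)) *\<^sub>R q
        = r + ((1 - \<alpha> / (\<alpha> + \<beta>)) * \<alpha> - (\<alpha> / (\<alpha> + \<beta>)) * \<beta>) *\<^sub>R d"
      by (simp add: p_def q_def algebra_simps)
    also have "(1 - \<alpha> / (\<alpha> + \<beta>)) * \<alpha> - (\<alpha> / (\<alpha> + \<beta>)) * \<beta> = 0"
      using ab by (simp add: field_simps)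
    finally show ?thesis
      unfolding in_segment using ab \<alpha> \<beta> pq
      by (intro conjI exI[of _ "\<alpha> / (\<alpha> + \<beta>)"]) auto
  qed
  have uniq: "F = G" if "F edge_of K" "G edge_of K" "z \<in> F" "z \<in> G" "z \<bullet> e = t" for F G z
  proof (rule ccontr)
    assume ne: "F \<noteq> G"
    have FG: "F face_of K" "G face_of K" "aff_dim F = 1" "aff_dim G = 1" "convex F" "convex G"
      using that face_of_imp_convex by (auto simp: edge_of_def)
    have I: "(F \<inter> G) face_of K" using FG face_of_Int by blast
    have IF: "(F \<inter> G) face_of F" "(F \<inter> G) face_of G"
      using I FG face_of_subset[of "F \<inter> G" K] face_of_imp_subset by auto
    have "F \<inter> G \<noteq> F \<or> F \<inter> G \<noteq> G" using ne by auto
    then have "aff_dim (F \<inter> G) < 1"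
      using face_of_aff_dim_lt IF FG by metis
    moreover have "aff_dim (F \<inter> G) \<ge> 0"
      using that(3,4) aff_dim_negative_iff[of "F \<inter> G"] by (metis IntI empty_iff not_less)
    ultimately have "aff_dim (F \<inter> G) = 0" by linarith
    then obtain w where "F \<inter> G = {w}" using aff_dim_eq_0 by metis
    then have "F \<inter> G = {z}" using that by auto
    then have "z extreme_point_of K" using I face_of_singleton by metis
    then have "z \<in> S" using extreme_point_of_convex_hull by (auto simp: K_def)
    then show False using t that by auto
  qed
  obtain P Q where P: "P edge_of K" "p \<in> P" and Q: "Q edge_of K" "q \<in> Q"
    using \<alpha>(2) \<beta>(2) fr by (auto simp: p_def q_def)
  have "P \<noteq> Q"
  proof
    assume "P = Q"
    moreover have "convex P" using P face_of_imp_convex by (auto simp: edge_of_def)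
    ultimately have "r \<in> P"
      using P Q rseg by (metis convex_contains_open_segment subsetD)
    then show False using P fr frK r by blast
  qed
  have "{F. F edge_of K \<and> t \<in> (\<lambda>x. x \<bullet> e) ` F} = {P, Q}"
  proof (intro equalityI subsetI)
    fix F assume "F \<in> {F. F edge_of K \<and> t \<in> (\<lambda>x. x \<bullet> e) ` F}"
    then obtain z where F: "F edge_of K" "z \<in> F" "z \<bullet> e = t" by auto
    then have "z \<in> frontier K" using fr by auto
    then have "z = p \<or> z = q" using two F by simp
    then show "F \<in> {P, Q}" using uniq[of F P z] uniq[of F Q z] F P Q by auto
  qed (use P Q imageI[of p P "\<lambda>x. x \<bullet> e"] imageI[of q Q "\<lambda>x. x \<bullet> e"] pe qe in auto)
  then show ?thesis using \<open>P \<noteq> Q\<close> by (simp add: K_def)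
qed

lemma inner_image_convex_hull:
  fixes S :: "'a::real_inner set"
  assumes "finite S" "S \<noteq> {}"
  shows "(\<lambda>x. x \<bullet> e) ` (convex hull S)
    = {Min ((\<lambda>x. x \<bullet> e) ` S) .. Max ((\<lambda>x. x \<bullet> e) ` S)}"
proof -
  let ?T = "(\<lambda>x. x \<bullet> e) ` S"
  have "(\<lambda>x. x \<bullet> e) ` (convex hull S) = convex hull ?T"
    by (intro convex_hull_linear_image linearI) (auto simp: inner_simps)
  also have "\<dots> = {Min ?T .. Max ?T}"
  proof
    show "convex hull ?T \<subseteq> {Min ?T .. Max ?T}"
      using assms by (intro hull_minimal) (auto simp: convex_real_interval)
    have "{Min ?T, Max ?T} \<subseteq> ?T"
      using assms Min_in[of ?T] Max_in[of ?T] by auto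
    then have "convex hull {Min ?T, Max ?T} \<subseteq> convex hull ?T"
      by (rule hull_mono)
    moreover have "Min ?T \<le> Max ?T" using assms by simp
    ultimately show "{Min ?T .. Max ?T} \<subseteq> convex hull ?T"
      by (simp add: closed_segment_eq_real_ivl flip: segment_convex_hull)
  qed
  finally show ?thesis .
qed

lemma emeasure_inner_image_segment:
  fixes a b e :: "'a::real_inner"
  shows "(\<lambda>x. x \<bullet> e) ` closed_segment a b \<in> sets lborel"
    "emeasure lborel ((\<lambda>x. x \<bullet> e) ` closed_segment a b) = \<bar>(b - a) \<bullet> e\<bar>"
proof -
  have "(\<lambda>x. x \<bullet> e) ` closed_segment a b = closed_segment (a \<bullet> e) (b \<bullet> e)"
    by (intro closed_segment_linear_image[symmetric] linearI) (auto simp: inner_simps)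
  then show "(\<lambda>x. x \<bullet> e) ` closed_segment a b \<in> sets lborel"
    "emeasure lborel ((\<lambda>x. x \<bullet> e) ` closed_segment a b) = \<bar>(b - a) \<bullet> e\<bar>"
    by (auto simp: closed_segment_eq_real_ivl inner_simps)
qed

text \<open>Integrating over \<open>t\<close> the number of edges that meet the line \<open>{x. x \<bullet> e = t}\<close> gives the total
  length of the shadows of the edges on the one hand. On the other hand this number is \<open>2\<close> for
  almost every \<open>t\<close> between the minimum and the maximum, and \<open>0\<close> outside.\<close>

lemma sum_edge_shadows_eq_twice_width:
  fixes S :: "(real^2) set"
  assumes S: "finite S" and dim: "aff_dim (convex hull S) = 2"
  shows "(\<Sum>F | F edge_of (convex hull S). emeasure lborel ((\<lambda>x. x \<bullet> e) ` F))
    = ennreal (2 * (Max ((\<lambda>x. x \<bullet> e) ` S) - Min ((\<lambda>x. x \<bullet> e) ` S)))"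
proof -
  let ?K = "convex hull S" and ?T = "(\<lambda>x. x \<bullet> e) ` S"
  let ?E = "{F. F edge_of ?K}" and ?m = "Min ?T" and ?M = "Max ?T"
  have ne: "S \<noteq> {}" using dim by auto
  have mM: "?m \<le> ?M" using S ne by simp
  have poly: "polytope ?K" using S by (auto simp: polytope_def)
  have fin: "finite ?E"
    using finite_polytope_faces[OF poly] by (rule finite_subset[rotated]) (auto simp: edge_of_def)
  have img: "(\<lambda>x. x \<bullet> e) ` ?K = {?m .. ?M}" using inner_image_convex_hull[OF S ne] .
  have meas: "(\<lambda>x. x \<bullet> e) ` F \<in> sets lborel" if "F \<in> ?E" for F
    using edge_of_polytope_segment[OF poly, of F] that emeasure_inner_image_segment(1)
    by (metis mem_Collect_eq)
  have count: "(\<Sum>F\<in>?E. indicator ((\<lambda>x. x \<bullet> e) ` F) t) = (2 * indicator {?m..?M} t :: ennreal)"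
    if t: "t \<notin> ?T" for t
  proof (cases "t \<in> {?m..?M}")
    case True
    have "?m \<in> ?T" "?M \<in> ?T" using S ne by auto
    then obtain x y where "x \<in> S" "?m = x \<bullet> e" "y \<in> S" "?M = y \<bullet> e" by (elim imageE)
    moreover have "?m < t" "t < ?M"
      using True t \<open>?m \<in> ?T\<close> \<open>?M \<in> ?T\<close> by (auto simp: less_le)
    ultimately have "card {F. F edge_of ?K \<and> t \<in> (\<lambda>x. x \<bullet> e) ` F} = 2"
      using t by (intro level_line_meets_two_edges[OF S dim, of x e t y]) (auto intro: hull_inc)
    moreover have "(\<Sum>F\<in>?E. indicator ((\<lambda>x. x \<bullet> e) ` F) t)
        = (of_nat (card {F. F edge_of ?K \<and> t \<in> (\<lambda>x. x \<bullet> e) ` F}) :: ennreal)"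
      using fin by (simp add: indicator_def sum.If_cases Int_def conj_commute of_bool_def)
    ultimately show ?thesis using True by simp
  next
    case False
    then have "t \<notin> (\<lambda>x. x \<bullet> e) ` F" if "F \<in> ?E" for F
      using img that edge_of_imp_subset[of F ?K] by blast
    then show ?thesis using False by (simp add: indicator_def)
  qed
  have "(\<Sum>F\<in>?E. emeasure lborel ((\<lambda>x. x \<bullet> e) ` F))
      = (\<Sum>F\<in>?E. \<integral>\<^sup>+t. indicator ((\<lambda>x. x \<bullet> e) ` F) t \<partial>lborel)"
    using meas by (intro sum.cong) auto
  also have "\<dots> = (\<integral>\<^sup>+t. (\<Sum>F\<in>?E. indicator ((\<lambda>x. x \<bullet> e) ` F) t) \<partial>lborel)"
    using meas by (intro nn_integral_sum[symmetric] borel_measurable_indicator)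
  also have "\<dots> = (\<integral>\<^sup>+t. 2 * indicator {?m..?M} t \<partial>lborel)"
  proof (rule nn_integral_cong_AE)
    have "?T \<in> null_sets lborel"
      using S by (intro finite_imp_null_set_lborel) auto
    then have "AE t in lborel. t \<notin> ?T" by (rule AE_not_in)
    then show "AE t in lborel. (\<Sum>F\<in>?E. indicator ((\<lambda>x. x \<bullet> e) ` F) t)
        = (2 * indicator {?m..?M} t :: ennreal)"
      by eventually_elim (rule count)
  qed
  also have "\<dots> = 2 * ennreal (?M - ?m)"
    using mM by (subst nn_integral_cmult_indicator) auto
  also have "\<dots> = ennreal (2 * (?M - ?m))"
    using mM by (subst ennreal_mult) auto
  finally show ?thesis .
qed

text \<open>Invariance under rotations, for the one function that is needed: the part of the shifted interval
  to the left of \<open>0\<close> is moved by a full period.\<close>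

lemma integral_abs_cos_shift:
  assumes "0 \<le> \<phi>" "\<phi> \<le> 2 * pi"
  shows "integral {0..2*pi} (\<lambda>\<theta>. \<bar>cos (\<theta> - \<phi>)\<bar>) = integral {0..2*pi} (\<lambda>\<theta>. \<bar>cos \<theta>\<bar>)"
proof -
  let ?f = "\<lambda>\<theta>::real. \<bar>cos \<theta>\<bar>"
  have int: "?f integrable_on {a..b}" for a b
    by (intro integrable_continuous_real continuous_intros)
  have "integral {0..2*pi} (\<lambda>\<theta>. ?f (\<theta> - \<phi>)) = integral {-\<phi>..2*pi-\<phi>} ?f"
    using integral_shift_Icc_real[of 0 "2*pi" ?f "-\<phi>"] by (simp add: o_def)
  also have "\<dots> = integral {-\<phi>..0} ?f + integral {0..2*pi-\<phi>} ?f"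
    using assms by (intro Henstock_Kurzweil_Integration.integral_combine[symmetric] int) auto
  also have "integral {-\<phi>..0} ?f = integral {2*pi-\<phi>..2*pi} ?f"
    using integral_shift_Icc_real[of "-\<phi>" 0 ?f "2*pi"] by (simp add: o_def add.commute)
  also have "\<dots> + integral {0..2*pi-\<phi>} ?f = integral {0..2*pi} ?f"
    using assms Henstock_Kurzweil_Integration.integral_combine[OF _ _ int, of 0 "2*pi-\<phi>" "2*pi"]
    by simp
  finally show ?thesis .
qed

lemma integral_abs_cos_pos: "integral {0..2*pi} (\<lambda>\<theta>. \<bar>cos \<theta>\<bar>) > 0"
proof -
  have cont: "continuous_on {0..2*pi} (\<lambda>\<theta>. \<bar>cos \<theta>\<bar>)" by (intro continuous_intros)
  have "integral {0..2*pi} (\<lambda>\<theta>. \<bar>cos \<theta>\<bar>) \<ge> 0"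
    by (intro Henstock_Kurzweil_Integration.integral_nonneg integrable_continuous_real cont) auto
  moreover have "integral {0..2*pi} (\<lambda>\<theta>. \<bar>cos \<theta>\<bar>) \<noteq> 0"
  proof
    assume "integral {0..2*pi} (\<lambda>\<theta>. \<bar>cos \<theta>\<bar>) = 0"
    then have "((\<lambda>\<theta>. \<bar>cos \<theta>\<bar>) has_integral 0) (cbox 0 (2*pi))"
      using integrable_integral[OF integrable_continuous_real[OF cont]] by simp
    then have "\<bar>cos 0\<bar> = (0::real)"
      using cont linorder_not_le[THEN iffD2, OF pi_gt_zero]
      by (intro has_integral_0_cbox_imp_0[of 0 "2*pi" "\<lambda>\<theta>. \<bar>cos \<theta>\<bar>" 0]) auto
    then show False by simp
  qed
  ultimately show ?thesis by simp
qed

text \<open>The measure is the uniform measure on the unit circle, of total mass \<open>2 * pi\<close>. Invariance under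
  rotations makes the integral of \<open>\<bar>v \<bullet> e\<bar>\<close> proportional to the norm of \<open>v\<close>. The
  constant \<open>c\<close> later cancels, so that only its sign matters.\<close>

lemma rotation_invariant_measure:
  obtains \<nu> :: "(real^2) measure" and c :: real
  where "finite_measure \<nu>" "sets \<nu> = sets borel" "c > 0"
    "\<And>v. (\<integral>\<^sup>+e. ennreal \<bar>v \<bullet> e\<bar> \<partial>\<nu>) = ennreal (c * norm v)"
proof -
  define E where "E = (\<lambda>\<theta>. cos \<theta> *\<^sub>R axis 1 1 + sin \<theta> *\<^sub>R axis 2 1 :: real^2)"
  define R where "R = restrict_space lborel {0..2*pi}"
  define c where "c = integral {0..2*pi} (\<lambda>\<theta>. \<bar>cos \<theta>\<bar>)"
  have E_components: "E \<theta> $ 1 = cos \<theta>" "E \<theta> $ 2 = sin \<theta>" for \<theta>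
    by (simp_all add: E_def axis_def)
  have E_inner: "v \<bullet> E \<theta> = v $ 1 * cos \<theta> + v $ 2 * sin \<theta>" for v \<theta>
    by (simp add: E_def inner_add_right inner_axis)
  have "continuous_on UNIV E"
    unfolding E_def by (intro continuous_intros)
  then have "E \<in> borel_measurable borel"
    by (rule borel_measurable_continuous_onI)
  then have E: "E \<in> borel_measurable R"
    unfolding R_def by (intro measurable_restrict_space1) simp
  have fin: "finite_measure R"
    unfolding R_def by (intro finite_measureI) (auto simp: emeasure_restrict_space space_restrict_space)
  have "(\<integral>\<^sup>+e. ennreal \<bar>v \<bullet> e\<bar> \<partial>distr R borel E) = ennreal (c * norm v)" for v
  proof -
    obtain \<phi> where \<phi>: "0 \<le> \<phi>" "\<phi> \<le> 2*pi" "v = norm v *\<^sub>R E \<phi>"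
    proof (cases "v = 0")
      case True
      then show thesis using that[of 0] by simp
    next
      case False
      have "(norm v)\<^sup>2 = (v $ 1)\<^sup>2 + (v $ 2)\<^sup>2"
        by (simp add: power2_norm_eq_inner inner_vec_def sum_2 flip: power2_eq_square)
      then have "(v $ 1 / norm v)\<^sup>2 + (v $ 2 / norm v)\<^sup>2 = 1"
        using False by (auto simp: vec_eq_iff forall_2 power_divide simp flip: add_divide_distrib)
      then obtain t where "0 \<le> t" "t < 2*pi" "v $ 1 / norm v = cos t" "v $ 2 / norm v = sin t"
        by (rule sincos_total_2pi)
      note t = this
      have "v $ 1 = norm v * cos t" "v $ 2 = norm v * sin t"
        using False by (simp_all flip: t(3,4))
      then have "v = norm v *\<^sub>R E t"
        by (simp add: vec_eq_iff forall_2 E_components)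
      then show thesis using t(1,2) that[of t] by simp
    qed
    have "E \<phi> \<bullet> E \<theta> = cos (\<theta> - \<phi>)" for \<theta>
      by (simp add: E_inner E_components cos_diff)
    then have inner: "v \<bullet> E \<theta> = norm v * cos (\<theta> - \<phi>)" for \<theta>
      using \<phi>(3) by (metis inner_scaleR_left)
    have "(\<integral>\<^sup>+e. ennreal \<bar>v \<bullet> e\<bar> \<partial>distr R borel E) = (\<integral>\<^sup>+\<theta>. ennreal \<bar>v \<bullet> E \<theta>\<bar> \<partial>R)"
      using E by (intro nn_integral_distr) auto
    also have "\<dots> = (\<integral>\<^sup>+\<theta>. ennreal \<bar>v \<bullet> E \<theta>\<bar> * indicator {0..2*pi} \<theta> \<partial>lborel)"
      unfolding R_def by (subst nn_integral_restrict_space) auto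
    also have "\<dots> = ennreal (integral {0..2*pi} (\<lambda>\<theta>. norm v * \<bar>cos (\<theta> - \<phi>)\<bar>))"
      unfolding inner abs_mult abs_norm_cancel
      by (intro nn_integral_has_integral_lebesgue' integrable_integral integrable_continuous_real
          continuous_intros) auto
    also have "integral {0..2*pi} (\<lambda>\<theta>. norm v * \<bar>cos (\<theta> - \<phi>)\<bar>) = c * norm v"
      using integral_abs_cos_shift[OF \<phi>(1,2)] by (simp add: c_def)
    finally show ?thesis .
  qed
  moreover have "finite_measure (distr R borel E)"
    using E fin finite_measure.finite_measure_distr by blast
  ultimately show thesis
    using that[of "distr R borel E" c] integral_abs_cos_pos by (simp add: c_def)
qed

text \<open>Cauchy's formula. For a polygon with interior it results from averaging
  \<open>sum_edge_shadows_eq_twice_width\<close> over all directions, because the shadow of an edge is an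
  interval of length \<open>\<bar>(b - a) \<bullet> e\<bar>\<close>. A segment has width \<open>\<bar>(b - a) \<bullet> e\<bar>\<close>,
  which agrees with the convention that its perimeter is twice its length.\<close>

lemma perimeter_eq_mean_width:
  fixes S :: "(real^2) set"
  assumes S: "finite S" "S \<noteq> {}" and sets: "sets \<nu> = sets borel" and c: "c > 0"
    and \<nu>: "\<And>v. (\<integral>\<^sup>+e. ennreal \<bar>v \<bullet> e\<bar> \<partial>\<nu>) = ennreal (c * norm v)"
  shows "ennreal (c * perimeter (convex hull S))
    = (\<integral>\<^sup>+e. ennreal (2 * (Max ((\<lambda>x. x \<bullet> e) ` S) - Min ((\<lambda>x. x \<bullet> e) ` S))) \<partial>\<nu>)"
proof (cases "aff_dim (convex hull S) = 2")
  case True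
  let ?E = "{F. F edge_of (convex hull S)}"
  have poly: "polytope (convex hull S)" using S by (auto simp: polytope_def)
  have *: "(\<lambda>e. emeasure lborel ((\<lambda>x. x \<bullet> e) ` F)) \<in> borel_measurable \<nu> \<and>
      ennreal (c * diameter F) = (\<integral>\<^sup>+e. emeasure lborel ((\<lambda>x. x \<bullet> e) ` F) \<partial>\<nu>) \<and> diameter F \<ge> 0"
    if "F \<in> ?E" for F
  proof -
    obtain a b where F: "F = closed_segment a b"
      using edge_of_polytope_segment[OF poly] \<open>F \<in> ?E\<close> by blast
    have "\<not> aff_dim F = 2" using \<open>F \<in> ?E\<close> by (simp add: edge_of_def)
    then have "diameter F = norm (b - a)"
      using perimeter_closed_segment[of a b] F
      by (simp add: perimeter_def dist_norm norm_minus_commute)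
    then show ?thesis
      using \<nu>[of "b - a"] by (simp add: F emeasure_inner_image_segment(2) measurable_cong_sets[OF sets refl])
  qed
  have "ennreal (c * perimeter (convex hull S)) = ennreal (\<Sum>F\<in>?E. c * diameter F)"
    using True by (simp add: perimeter_def sum_distrib_left)
  also have "\<dots> = (\<Sum>F\<in>?E. ennreal (c * diameter F))"
    using * c by (intro sum_ennreal[symmetric]) auto
  also have "\<dots> = (\<Sum>F\<in>?E. \<integral>\<^sup>+e. emeasure lborel ((\<lambda>x. x \<bullet> e) ` F) \<partial>\<nu>)"
    using * by (intro sum.cong) auto
  also have "\<dots> = (\<integral>\<^sup>+e. (\<Sum>F\<in>?E. emeasure lborel ((\<lambda>x. x \<bullet> e) ` F)) \<partial>\<nu>)"
    using * by (intro nn_integral_sum[symmetric]) auto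
  finally show ?thesis
    by (simp add: sum_edge_shadows_eq_twice_width[OF S(1) True])
next
  case False
  have "aff_dim (convex hull S) \<le> 2"
    using aff_dim_le_DIM[of "convex hull S"] by simp
  then have "collinear (convex hull S)" using False by (simp add: collinear_aff_dim)
  then obtain a b where ab: "convex hull S = closed_segment a b"
    using S by (metis compact_convex_collinear_segment convex_convex_hull convex_hull_eq_empty
        finite_imp_compact_convex_hull)
  have width: "Max ((\<lambda>x. x \<bullet> e) ` S) - Min ((\<lambda>x. x \<bullet> e) ` S) = \<bar>(b - a) \<bullet> e\<bar>" for e
  proof -
    have "Min ((\<lambda>x. x \<bullet> e) ` S) \<le> Max ((\<lambda>x. x \<bullet> e) ` S)" using S by simp
    then have "ennreal (Max ((\<lambda>x. x \<bullet> e) ` S) - Min ((\<lambda>x. x \<bullet> e) ` S)) = ennreal \<bar>(b - a) \<bullet> e\<bar>"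
      using emeasure_inner_image_segment(2)[of e a b] inner_image_convex_hull[OF S, of e]
      by (simp add: ab)
    then show ?thesis
      using \<open>Min ((\<lambda>x. x \<bullet> e) ` S) \<le> Max ((\<lambda>x. x \<bullet> e) ` S)\<close> by simp
  qed
  have "ennreal (c * perimeter (convex hull S)) = ennreal (c * norm (2 *\<^sub>R (b - a)))"
    by (simp add: ab perimeter_closed_segment dist_norm norm_minus_commute)
  also have "\<dots> = (\<integral>\<^sup>+e. ennreal \<bar>(2 *\<^sub>R (b - a)) \<bullet> e\<bar> \<partial>\<nu>)"
    by (simp only: \<nu>)
  also have "\<dots> = (\<integral>\<^sup>+e. ennreal (2 * (Max ((\<lambda>x. x \<bullet> e) ` S) - Min ((\<lambda>x. x \<bullet> e) ` S))) \<partial>\<nu>)"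
    unfolding width by (simp add: abs_mult)
  finally show ?thesis .
qed

section \<open>The expected maximum of a random walk on the line\<close>

lemma (in prob_space) iid_compose:
  assumes indep: "indep_vars (\<lambda>_. borel) Z UNIV"
    and ident: "\<And>n::nat. distr M borel (Z n) = distr M borel (Z 0)"
    and f [measurable]: "f \<in> borel_measurable borel"
  shows "indep_vars (\<lambda>_. borel) (\<lambda>i \<omega>. f (Z i \<omega>)) UNIV"
    "distr M borel (\<lambda>\<omega>. f (Z i \<omega>)) = distr M borel (\<lambda>\<omega>. f (Z 0 \<omega>))"
proof -
  have [measurable]: "Z i \<in> borel_measurable M" for i
    using indep by (auto simp: indep_vars_def)
  show "indep_vars (\<lambda>_. borel) (\<lambda>i \<omega>. f (Z i \<omega>)) UNIV"
    by (intro indep_vars_compose2[OF indep]) auto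
  have "distr M borel (\<lambda>\<omega>. f (Z i \<omega>)) = distr (distr M borel (Z i)) borel f" for i
    by (subst distr_distr) (auto simp: o_def)
  then show "distr M borel (\<lambda>\<omega>. f (Z i \<omega>)) = distr M borel (\<lambda>\<omega>. f (Z 0 \<omega>))"
    by (simp add: ident[of i])
qed

lemma ident_expectation:
  fixes f :: "'b::topological_space \<Rightarrow> 'c::{banach, second_countable_topology}"
  assumes "distr M borel X = distr M borel Y"
    and [measurable]: "X \<in> borel_measurable M" "Y \<in> borel_measurable M" "f \<in> borel_measurable borel"
  shows "(LINT \<omega>|M. f (X \<omega>)) = (LINT \<omega>|M. f (Y \<omega>))"
    "integrable M (\<lambda>\<omega>. f (X \<omega>)) \<longleftrightarrow> integrable M (\<lambda>\<omega>. f (Y \<omega>))"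
proof -
  show "(LINT \<omega>|M. f (X \<omega>)) = (LINT \<omega>|M. f (Y \<omega>))"
    using integral_distr[of X M borel f] integral_distr[of Y M borel f] assms by simp
  show "integrable M (\<lambda>\<omega>. f (X \<omega>)) \<longleftrightarrow> integrable M (\<lambda>\<omega>. f (Y \<omega>))"
    using integrable_distr_eq[of X M borel f] integrable_distr_eq[of Y M borel f] assms by simp
qed

text \<open>The joint law of distinct members of an i.i.d. family is the product of copies of the common law,
  whichever members are chosen. This is the exchangeability used below.\<close>

lemma (in prob_space) iid_reindex:
  fixes X :: "nat \<Rightarrow> 'a \<Rightarrow> real" and I :: "nat set"
  assumes indep: "indep_vars (\<lambda>_. borel) X UNIV"
    and ident: "\<And>n. distr M borel (X n) = distr M borel (X 0)"
    and \<pi>: "inj_on \<pi> I" "I \<noteq> {}"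
  shows "distr M (\<Pi>\<^sub>M i\<in>I. borel) (\<lambda>\<omega>. \<lambda>i\<in>I. X (\<pi> i) \<omega>)
    = (\<Pi>\<^sub>M i\<in>I. distr M borel (X 0))"
proof -
  have rv [measurable]: "X i \<in> borel_measurable M" for i
    using indep by (auto simp: indep_vars_def)
  let ?J = "\<pi> ` I" and ?D = "distr M borel (X 0)"
  have D: "prob_space ?D" by (intro prob_space_distr) auto
  have sets [measurable_cong]: "sets (\<Pi>\<^sub>M i\<in>K. ?D) = sets (\<Pi>\<^sub>M i\<in>K. borel)" for K :: "nat set"
    by (intro sets_PiM_cong) auto
  have "distr M (\<Pi>\<^sub>M i\<in>?J. borel) (\<lambda>\<omega>. \<lambda>i\<in>?J. X i \<omega>) = (\<Pi>\<^sub>M i\<in>?J. distr M borel (X i))"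
    using indep_vars_iff_distr_eq_PiM[where I = ?J and M' = "\<lambda>_. borel" and X = X] indep_vars_subset[OF indep, of ?J] \<pi>
    by auto
  also have "\<dots> = (\<Pi>\<^sub>M i\<in>?J. ?D)"
    by (intro PiM_cong) (auto intro: ident)
  finally have J: "distr M (\<Pi>\<^sub>M i\<in>?J. borel) (\<lambda>\<omega>. \<lambda>i\<in>?J. X i \<omega>) = (\<Pi>\<^sub>M i\<in>?J. ?D)" .
  have "(\<Pi>\<^sub>M i\<in>I. ?D) = distr (\<Pi>\<^sub>M i\<in>?J. ?D) (\<Pi>\<^sub>M i\<in>I. ?D) (\<lambda>\<omega>. \<lambda>n\<in>I. \<omega> (\<pi> n))"
    using \<pi> D by (intro distr_PiM_reindex[symmetric]) auto
  also have "\<dots> = distr (\<Pi>\<^sub>M i\<in>?J. ?D) (\<Pi>\<^sub>M i\<in>I. borel) (\<lambda>\<omega>. \<lambda>n\<in>I. \<omega> (\<pi> n))"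
    by (intro distr_cong refl sets)
  also have "\<dots> = distr M (\<Pi>\<^sub>M i\<in>I. borel) ((\<lambda>\<omega>. \<lambda>n\<in>I. \<omega> (\<pi> n)) \<circ> (\<lambda>\<omega>. \<lambda>i\<in>?J. X i \<omega>))"
    unfolding J[symmetric] by (intro distr_distr) measurable
  also have "\<dots> = distr M (\<Pi>\<^sub>M i\<in>I. borel) (\<lambda>\<omega>. \<lambda>i\<in>I. X (\<pi> i) \<omega>)"
    by (intro distr_cong) (auto simp: fun_eq_iff)
  finally show ?thesis by simp
qed

lemma (in prob_space) iid_expectation_permute:
  fixes X :: "nat \<Rightarrow> 'a \<Rightarrow> real" and f :: "(nat \<Rightarrow> real) \<Rightarrow> real"
  assumes indep: "indep_vars (\<lambda>_. borel) X UNIV"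
    and ident: "\<And>n. distr M borel (X n) = distr M borel (X 0)"
    and \<pi>: "inj_on \<pi> I" "I \<noteq> {}"
    and f: "f \<in> borel_measurable (\<Pi>\<^sub>M i\<in>I. borel)"
  shows "expectation (\<lambda>\<omega>. f (\<lambda>i\<in>I. X (\<pi> i) \<omega>)) = expectation (\<lambda>\<omega>. f (\<lambda>i\<in>I. X i \<omega>))"
proof -
  have rv [measurable]: "X i \<in> borel_measurable M" for i
    using indep by (auto simp: indep_vars_def)
  note f[measurable]
  have "expectation (\<lambda>\<omega>. f (\<lambda>i\<in>I. X (\<pi> i) \<omega>))
      = (LINT x|distr M (\<Pi>\<^sub>M i\<in>I. borel) (\<lambda>\<omega>. \<lambda>i\<in>I. X (\<pi> i) \<omega>). f x)"
    by (intro integral_distr[symmetric]) measurable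
  also have "\<dots> = (LINT x|distr M (\<Pi>\<^sub>M i\<in>I. borel) (\<lambda>\<omega>. \<lambda>i\<in>I. X i \<omega>). f x)"
    using iid_reindex[OF indep ident, of \<pi> I] iid_reindex[OF indep ident, of "\<lambda>i. i" I] \<pi> by simp
  also have "\<dots> = expectation (\<lambda>\<omega>. f (\<lambda>i\<in>I. X i \<omega>))"
    by (intro integral_distr) measurable
  finally show ?thesis .
qed

text \<open>Indices start at \<open>1\<close>, as in the definition of the walk.\<close>

definition partial_sum :: "(nat \<Rightarrow> 'b::comm_monoid_add) \<Rightarrow> nat \<Rightarrow> 'b" where
  "partial_sum x k = (\<Sum>i=1..k. x i)"

definition running_max :: "(nat \<Rightarrow> real) \<Rightarrow> nat \<Rightarrow> real" where
  "running_max x n = Max (partial_sum x ` {0..n})"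

lemma running_max_0: "running_max x 0 = 0"
  by (simp add: running_max_def partial_sum_def)

lemma running_max_Suc: "running_max x (Suc n) = max (running_max x n) (partial_sum x (Suc n))"
  by (simp add: running_max_def atLeast0_atMost_Suc max.commute)

lemma partial_sum_Suc: "partial_sum x (Suc n) = partial_sum x n + x (Suc n)"
  by (simp add: partial_sum_def)

lemma running_max_nonneg: "0 \<le> running_max x n"
  by (induction n) (auto simp: running_max_0 running_max_Suc)

lemma partial_sum_le_running_max: "partial_sum x n \<le> running_max x n"
  by (cases n) (auto simp: running_max_0 running_max_Suc, simp add: partial_sum_def)

lemma partial_sum_shift: "partial_sum x (Suc n) = x 1 + partial_sum (\<lambda>i. x (Suc i)) n"
  by (induction n) (simp_all add: partial_sum_def add.assoc)

lemma running_max_shift: "running_max x (Suc n) = max 0 (x 1 + running_max (\<lambda>i. x (Suc i)) n)"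
proof (induction n)
  case 0
  show ?case by (simp add: running_max_Suc running_max_0 partial_sum_def)
next
  case (Suc n)
  have "running_max x (Suc (Suc n)) = max (running_max x (Suc n)) (partial_sum x (Suc (Suc n)))"
    by (rule running_max_Suc)
  also have "partial_sum x (Suc (Suc n)) = x 1 + partial_sum (\<lambda>i. x (Suc i)) (Suc n)"
    by (rule partial_sum_shift)
  also have "max (running_max x (Suc n)) \<dots>
      = max 0 (x 1 + max (running_max (\<lambda>i. x (Suc i)) n) (partial_sum (\<lambda>i. x (Suc i)) (Suc n)))"
    unfolding Suc by linarith
  finally show ?case by (simp only: running_max_Suc)
qed

lemma partial_sum_cong: "(\<And>i. i \<in> {1..n} \<Longrightarrow> x i = y i) \<Longrightarrow> partial_sum x n = partial_sum y n"
  unfolding partial_sum_def by (rule sum.cong) auto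

lemma running_max_cong: "(\<And>i. i \<in> {1..n} \<Longrightarrow> x i = y i) \<Longrightarrow> running_max x n = running_max y n"
  unfolding running_max_def by (intro arg_cong[of _ _ Max] image_cong partial_sum_cong) auto

lemma running_max_le_sum_abs: "running_max x n \<le> (\<Sum>i=1..n. \<bar>x i\<bar>)"
proof (induction n)
  case (Suc n)
  have "partial_sum x (Suc n) \<le> (\<Sum>i=1..Suc n. \<bar>x i\<bar>)"
    unfolding partial_sum_def by (rule sum_mono) auto
  then show ?case using Suc by (auto simp: running_max_Suc)
qed (simp add: running_max_0)

lemma borel_measurable_partial_sum [measurable (raw)]:
  assumes "\<And>i. i \<in> {1..n} \<Longrightarrow> (\<lambda>\<omega>. x \<omega> i) \<in> borel_measurable N"
  shows "(\<lambda>\<omega>. partial_sum (x \<omega>) n :: real) \<in> borel_measurable N"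
  unfolding partial_sum_def by (intro borel_measurable_sum assms)

lemma borel_measurable_running_max [measurable (raw)]:
  assumes "\<And>i. i \<in> {1..n} \<Longrightarrow> (\<lambda>\<omega>. x \<omega> i) \<in> borel_measurable N"
  shows "(\<lambda>\<omega>. running_max (x \<omega>) n) \<in> borel_measurable N"
  using assms
proof (induction n)
  case (Suc n)
  then show ?case unfolding running_max_Suc
    by (intro borel_measurable_max borel_measurable_partial_sum) auto
qed (simp add: running_max_0)

lemma (in prob_space) integrable_running_max:
  fixes X :: "nat \<Rightarrow> 'a \<Rightarrow> real"
  assumes "\<And>i. integrable M (X i)"
  shows "integrable M (\<lambda>\<omega>. running_max (\<lambda>i. X i \<omega>) n)"
proof (rule Bochner_Integration.integrable_bound)
  show "integrable M (\<lambda>\<omega>. \<Sum>i=1..n. \<bar>X i \<omega>\<bar>)" using assms by auto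
  show "(\<lambda>\<omega>. running_max (\<lambda>i. X i \<omega>) n) \<in> borel_measurable M"
    using assms by (intro borel_measurable_running_max) auto
  show "AE \<omega> in M. norm (running_max (\<lambda>i. X i \<omega>) n) \<le> norm (\<Sum>i=1..n. \<bar>X i \<omega>\<bar>)"
    using running_max_nonneg running_max_le_sum_abs by (auto intro!: AE_I2 simp: sum_nonneg)
qed

text \<open>On the event that the sum of all \<open>n + 1\<close> increments is not positive, the maximum is already
  attained among the first \<open>n\<close> steps. On the complementary event, which is invariant under
  permutations, the maximum is the first increment plus the maximum of the shifted walk. A cyclic
  shift of the increments replaces the shifted walk by the original one, and by exchangeability the first
  increment contributes the fraction \<open>1 / (n + 1)\<close> of the positive part of the sum.\<close>

lemma (in prob_space) expectation_running_max_step: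
  fixes X :: "nat \<Rightarrow> 'a \<Rightarrow> real"
  assumes indep: "indep_vars (\<lambda>_. borel) X UNIV"
    and ident: "\<And>n. distr M borel (X n) = distr M borel (X 0)"
    and int: "\<And>i. integrable M (X i)"
  shows "expectation (\<lambda>\<omega>. running_max (\<lambda>i. X i \<omega>) (Suc n))
    = expectation (\<lambda>\<omega>. running_max (\<lambda>i. X i \<omega>) n)
      + expectation (\<lambda>\<omega>. max 0 (partial_sum (\<lambda>i. X i \<omega>) (Suc n))) / real (Suc n)"
proof -
  let ?N = "Suc n" and ?I = "{1..Suc n}"
  define P where "P = (\<lambda>x :: nat \<Rightarrow> real. if partial_sum x ?N > 0 then 1 else 0 :: real)"
  have P: "P \<in> borel_measurable (\<Pi>\<^sub>M i\<in>?I. borel)"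
  proof -
    have [measurable]: "(\<lambda>x :: nat \<Rightarrow> real. partial_sum x ?N) \<in> borel_measurable (\<Pi>\<^sub>M i\<in>?I. borel)"
      by (intro borel_measurable_partial_sum measurable_component_singleton)
    show ?thesis unfolding P_def by measurable
  qed
  have P_cong: "P x = P y" if "partial_sum x ?N = partial_sum y ?N" for x y
    using that by (simp add: P_def)
  define X' where "X' = (\<lambda>\<omega> i. X i \<omega>)"
  have rv [measurable]: "X i \<in> borel_measurable M" for i using int by auto
  have PX: "(\<lambda>\<omega>. P (X' \<omega>)) \<in> borel_measurable M"
    unfolding P_def X'_def by measurable
  have Pint: "integrable M (\<lambda>\<omega>. P (X' \<omega>) * Y \<omega>)" if "integrable M Y" for Y
    using that PX
    by (intro Bochner_Integration.integrable_bound[OF that]) (auto simp: P_def)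
  have swap_sum: "partial_sum (\<lambda>i. x (\<pi> i)) ?N = partial_sum x ?N" if "bij_betw \<pi> ?I ?I" for x :: "nat \<Rightarrow> real" and \<pi>
    unfolding partial_sum_def by (rule sum.reindex_bij_betw[OF that])
  have res: "partial_sum (\<lambda>i\<in>?I. x i) ?N = partial_sum x ?N" "running_max (\<lambda>i\<in>?I. x i) n = running_max x n" for x :: "nat \<Rightarrow> real"
    by (auto intro!: partial_sum_cong running_max_cong)
  \<comment> \<open>A transposition of the increments exchanges the two integrands.\<close>
  have coord: "expectation (\<lambda>\<omega>. P (X' \<omega>) * X j \<omega>) = expectation (\<lambda>\<omega>. P (X' \<omega>) * X 1 \<omega>)"
    if j: "j \<in> ?I" for j
  proof -
    define \<pi> where "\<pi> = Transposition.transpose 1 j"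
    have bij: "bij_betw \<pi> ?I ?I"
      using j unfolding \<pi>_def by (intro bij_betw_transpose_iff) simp
    let ?f = "\<lambda>x. P x * x 1"
    have f: "?f \<in> borel_measurable (\<Pi>\<^sub>M i\<in>?I. borel)"
      using P by (intro borel_measurable_times measurable_component_singleton) auto
    have "expectation (\<lambda>\<omega>. ?f (\<lambda>i\<in>?I. X (\<pi> i) \<omega>)) = expectation (\<lambda>\<omega>. ?f (\<lambda>i\<in>?I. X i \<omega>))"
      using bij f by (intro iid_expectation_permute indep ident) (auto simp: bij_betw_def)
    moreover have "P (\<lambda>i\<in>?I. X (\<pi> i) \<omega>) = P (X' \<omega>)" "P (\<lambda>i\<in>?I. X i \<omega>) = P (X' \<omega>)" for \<omega>
      by (rule P_cong, simp only: res X'_def swap_sum[OF bij, of "\<lambda>i. X i \<omega>"])+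
    moreover have "\<pi> 1 = j" by (simp add: \<pi>_def)
    ultimately show ?thesis by simp
  qed
  have first: "expectation (\<lambda>\<omega>. P (X' \<omega>) * X 1 \<omega>)
      = expectation (\<lambda>\<omega>. max 0 (partial_sum (X' \<omega>) ?N)) / real ?N"
  proof -
    have "expectation (\<lambda>\<omega>. max 0 (partial_sum (X' \<omega>) ?N)) = expectation (\<lambda>\<omega>. \<Sum>j\<in>?I. P (X' \<omega>) * X j \<omega>)"
      by (intro Bochner_Integration.integral_cong)
        (auto simp: P_def partial_sum_def X'_def max_def simp flip: sum_distrib_left)
    also have "\<dots> = (\<Sum>j\<in>?I. expectation (\<lambda>\<omega>. P (X' \<omega>) * X j \<omega>))"
      using Pint int by (intro Bochner_Integration.integral_sum) auto
    also have "\<dots> = (\<Sum>j\<in>?I. expectation (\<lambda>\<omega>. P (X' \<omega>) * X 1 \<omega>))"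
      by (intro sum.cong coord) auto
    finally show ?thesis by simp
  qed
  have shift: "expectation (\<lambda>\<omega>. P (X' \<omega>) * running_max (\<lambda>i. X (Suc i) \<omega>) n)
      = expectation (\<lambda>\<omega>. P (X' \<omega>) * running_max (X' \<omega>) n)"
  proof -
    \<comment> \<open>The cyclic shift carries the first \<open>n\<close> increments to the last \<open>n\<close> ones.\<close>
    define \<pi> where "\<pi> = (\<lambda>i. if i = ?N then 1 else Suc i)"
    have bij: "bij_betw \<pi> ?I ?I"
      by (rule bij_betw_byWitness[where f' = "\<lambda>i. if i = 1 then ?N else i - 1"]) (auto simp: \<pi>_def)
    let ?f = "\<lambda>x. P x * running_max x n"
    have f: "?f \<in> borel_measurable (\<Pi>\<^sub>M i\<in>?I. borel)"
      using P by (intro borel_measurable_times borel_measurable_running_max measurable_component_singleton) auto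
    have "expectation (\<lambda>\<omega>. ?f (\<lambda>i\<in>?I. X (\<pi> i) \<omega>)) = expectation (\<lambda>\<omega>. ?f (\<lambda>i\<in>?I. X i \<omega>))"
      using bij f by (intro iid_expectation_permute indep ident) (auto simp: bij_betw_def)
    moreover have "P (\<lambda>i\<in>?I. X (\<pi> i) \<omega>) = P (X' \<omega>)" "P (\<lambda>i\<in>?I. X i \<omega>) = P (X' \<omega>)" for \<omega>
      by (rule P_cong, simp only: res X'_def swap_sum[OF bij, of "\<lambda>i. X i \<omega>"])+
    moreover have "running_max (\<lambda>i. X (\<pi> i) \<omega>) n = running_max (\<lambda>i. X (Suc i) \<omega>) n" for \<omega>
      by (rule running_max_cong) (auto simp: \<pi>_def)
    ultimately show ?thesis by (simp add: res(2)[simplified] X'_def)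
  qed
  have split: "running_max (X' \<omega>) ?N = P (X' \<omega>) * X 1 \<omega> + P (X' \<omega>) * running_max (\<lambda>i. X (Suc i) \<omega>) n
      + (running_max (X' \<omega>) n - P (X' \<omega>) * running_max (X' \<omega>) n)" for \<omega>
  proof (cases "partial_sum (X' \<omega>) ?N > 0")
    case True
    have "X 1 \<omega> + running_max (\<lambda>i. X (Suc i) \<omega>) n > 0"
      using True partial_sum_shift[of "X' \<omega>" n] partial_sum_le_running_max[of "\<lambda>i. X (Suc i) \<omega>" n] by (simp add: X'_def)
    then have "running_max (X' \<omega>) ?N = X 1 \<omega> + running_max (\<lambda>i. X (Suc i) \<omega>) n"
      using running_max_shift[of "X' \<omega>" n] by (simp add: X'_def)
    then show ?thesis using True by (simp add: P_def)
  next
    case False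
    then have "running_max (X' \<omega>) ?N = running_max (X' \<omega>) n"
      using running_max_nonneg[of "X' \<omega>" n] by (simp add: running_max_Suc)
    then show ?thesis using False by (simp add: P_def)
  qed
  have intM: "integrable M (\<lambda>\<omega>. running_max (X' \<omega>) n)"
    using int integrable_running_max[of X n] by (simp add: X'_def)
  have i: "integrable M (\<lambda>\<omega>. P (X' \<omega>) * X 1 \<omega>)"
    "integrable M (\<lambda>\<omega>. P (X' \<omega>) * running_max (\<lambda>i. X (Suc i) \<omega>) n)"
    "integrable M (\<lambda>\<omega>. P (X' \<omega>) * running_max (X' \<omega>) n)" "integrable M (\<lambda>\<omega>. running_max (X' \<omega>) n)"
    using int integrable_running_max[of "\<lambda>i. X (Suc i)" n] intM by (simp_all add: Pint)
  have "expectation (\<lambda>\<omega>. running_max (X' \<omega>) ?N) = expectation (\<lambda>\<omega>. P (X' \<omega>) * X 1 \<omega>)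
      + expectation (\<lambda>\<omega>. P (X' \<omega>) * running_max (\<lambda>i. X (Suc i) \<omega>) n)
      + (expectation (\<lambda>\<omega>. running_max (X' \<omega>) n) - expectation (\<lambda>\<omega>. P (X' \<omega>) * running_max (X' \<omega>) n))"
    unfolding split using i by simp
  then show ?thesis unfolding shift first by (simp add: X'_def)
qed

text \<open>The formula of Kac and Spitzer for the expected maximum.\<close>

lemma (in prob_space) expectation_running_max:
  fixes X :: "nat \<Rightarrow> 'a \<Rightarrow> real"
  assumes indep: "indep_vars (\<lambda>_. borel) X UNIV"
    and ident: "\<And>n. distr M borel (X n) = distr M borel (X 0)"
    and int: "\<And>i. integrable M (X i)"
  shows "expectation (\<lambda>\<omega>. running_max (\<lambda>i. X i \<omega>) n)
    = (\<Sum>k=1..n. expectation (\<lambda>\<omega>. max 0 (partial_sum (\<lambda>i. X i \<omega>) k)) / real k)"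
  by (induction n) (simp_all add: running_max_0 expectation_running_max_step[OF indep ident int])

section \<open>The expected perimeter as a sum of expected distances\<close>

lemma perimeter_nonneg:
  assumes "finite S"
  shows "perimeter (convex hull S) \<ge> 0"
proof -
  have bdd: "bounded (convex hull S)" using assms by (simp add: finite_imp_bounded_convex_hull)
  then have "diameter F \<ge> 0" if "F edge_of (convex hull S)" for F
    using that edge_of_imp_subset bounded_subset diameter_ge_0 by metis
  then show ?thesis
    using diameter_ge_0[OF bdd] by (auto simp: perimeter_def intro: sum_nonneg)
qed

lemma walk_inner: "walk Z k \<omega> \<bullet> e = partial_sum (\<lambda>i. Z i \<omega> \<bullet> e) k"
  by (simp add: walk_def partial_sum_def inner_sum_left)

lemma width_walk:
  "Max ((\<lambda>x. x \<bullet> e) ` (\<lambda>k. walk Z k \<omega>) ` {0..n}) - Min ((\<lambda>x. x \<bullet> e) ` (\<lambda>k. walk Z k \<omega>) ` {0..n})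
    = running_max (\<lambda>i. Z i \<omega> \<bullet> e) n + running_max (\<lambda>i. - (Z i \<omega> \<bullet> e)) n"
proof -
  have img: "(\<lambda>x. x \<bullet> e) ` (\<lambda>k. walk Z k \<omega>) ` {0..n} = partial_sum (\<lambda>i. Z i \<omega> \<bullet> e) ` {0..n}"
    by (simp add: image_image walk_inner)
  have "partial_sum (\<lambda>i. - (Z i \<omega> \<bullet> e)) ` {0..n} = uminus ` partial_sum (\<lambda>i. Z i \<omega> \<bullet> e) ` {0..n}"
    by (simp add: image_image partial_sum_def sum_negf)
  then have "running_max (\<lambda>i. - (Z i \<omega> \<bullet> e)) n = - Min (partial_sum (\<lambda>i. Z i \<omega> \<bullet> e) ` {0..n})"
    by (simp add: running_max_def minus_Min_eq_Max)
  then show ?thesis unfolding img by (simp add: running_max_def)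
qed

text \<open>The minimum of the projected walk is minus the maximum of the walk with the opposite increments, so
  the Kac--Spitzer formula applies to both ends; positive and negative parts add up to the absolute
  value.\<close>

lemma (in prob_space) expectation_width:
  fixes Z :: "nat \<Rightarrow> 'a \<Rightarrow> real^2"
  assumes indep: "indep_vars (\<lambda>_. borel) Z UNIV"
    and ident: "\<And>n. distr M borel (Z n) = distr M borel (Z 0)"
    and int: "\<And>i. integrable M (Z i)"
  shows "expectation (\<lambda>\<omega>. running_max (\<lambda>i. Z i \<omega> \<bullet> e) n + running_max (\<lambda>i. - (Z i \<omega> \<bullet> e)) n)
    = (\<Sum>k=1..n. expectation (\<lambda>\<omega>. \<bar>walk Z k \<omega> \<bullet> e\<bar>) / real k)"
proof -
  have rv [measurable]: "Z i \<in> borel_measurable M" for i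
    using int by auto
  have int': "integrable M (\<lambda>\<omega>. Z i \<omega> \<bullet> e)" "integrable M (\<lambda>\<omega>. - (Z i \<omega> \<bullet> e))" for i
    using int by auto
  have intw: "integrable M (\<lambda>\<omega>. walk Z k \<omega> \<bullet> e)" for k
    unfolding walk_def using int by auto
  have neg: "partial_sum (\<lambda>i. - (Z i \<omega> \<bullet> e)) k = - (walk Z k \<omega> \<bullet> e)" for k \<omega>
    by (simp add: walk_inner partial_sum_def sum_negf)
  have "expectation (\<lambda>\<omega>. running_max (\<lambda>i. Z i \<omega> \<bullet> e) n + running_max (\<lambda>i. - (Z i \<omega> \<bullet> e)) n)
      = expectation (\<lambda>\<omega>. running_max (\<lambda>i. Z i \<omega> \<bullet> e) n) + expectation (\<lambda>\<omega>. running_max (\<lambda>i. - (Z i \<omega> \<bullet> e)) n)"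
    using int' by (intro Bochner_Integration.integral_add integrable_running_max)
  also have "\<dots> = (\<Sum>k=1..n. expectation (\<lambda>\<omega>. max 0 (walk Z k \<omega> \<bullet> e)) / real k)
      + (\<Sum>k=1..n. expectation (\<lambda>\<omega>. max 0 (- (walk Z k \<omega> \<bullet> e))) / real k)"
    by (subst (1 2) expectation_running_max)
       (use iid_compose[OF indep ident, of "\<lambda>x. x \<bullet> e"] iid_compose[OF indep ident, of "\<lambda>x. - (x \<bullet> e)"]
         int' in \<open>auto simp: walk_inner[symmetric] neg\<close>)
  also have "\<dots> = (\<Sum>k=1..n. expectation (\<lambda>\<omega>. max 0 (walk Z k \<omega> \<bullet> e) + max 0 (- (walk Z k \<omega> \<bullet> e))) / real k)"
    using intw by (simp add: add_divide_distrib sum.distrib)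
  also have "\<dots> = (\<Sum>k=1..n. expectation (\<lambda>\<omega>. \<bar>walk Z k \<omega> \<bullet> e\<bar>) / real k)"
    by (intro sum.cong arg_cong2[of _ _ _ _ "(/)"] Bochner_Integration.integral_cong) (auto simp: max_def)
  finally show ?thesis .
qed

text \<open>The Spitzer--Widom formula. By \<open>perimeter_eq_mean_width\<close> and Fubini's theorem the expected
  perimeter is an average of expected widths over all directions. These are sums of expectations of
  \<open>\<bar>S\<^sub>k \<bullet> e\<bar>\<close>, and averaging them over \<open>e\<close> gives multiples of \<open>\<parallel>S\<^sub>k\<parallel>\<close> with the same constant \<open>c\<close>.
  The representation by widths also shows that the perimeter is a measurable function.\<close>

lemma (in prob_space) expectation_hull_perimeter:
  fixes Z :: "nat \<Rightarrow> 'a \<Rightarrow> real^2"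
  assumes indep: "indep_vars (\<lambda>_. borel) Z UNIV"
    and ident: "\<And>n. distr M borel (Z n) = distr M borel (Z 0)"
    and int: "\<And>i. integrable M (Z i)"
  shows "expectation (hull_perimeter Z n) = (\<Sum>k=1..n. 2 * expectation (\<lambda>\<omega>. norm (walk Z k \<omega>)) / real k)"
proof -
  obtain \<nu> :: "(real^2) measure" and c where fin: "finite_measure \<nu>"
    and sets_\<nu> [measurable_cong]: "sets \<nu> = sets borel"
    and c: "c > 0" and \<nu>: "\<And>v. (\<integral>\<^sup>+e. ennreal \<bar>v \<bullet> e\<bar> \<partial>\<nu>) = ennreal (c * norm v)"
    using rotation_invariant_measure by blast
  interpret \<nu>: finite_measure \<nu> by fact
  interpret pair_sigma_finite M \<nu> ..
  have rv [measurable]: "Z i \<in> borel_measurable M" for i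
    using int by auto
  have walk [measurable]: "walk Z k \<in> borel_measurable M" for k
    unfolding walk_def by measurable
  have int_walk: "integrable M (walk Z k)" for k
    unfolding walk_def using int by auto
  define w where "w = (\<lambda>\<omega> e. running_max (\<lambda>i. Z i \<omega> \<bullet> e) n + running_max (\<lambda>i. - (Z i \<omega> \<bullet> e)) n)"
  have w0: "w \<omega> e \<ge> 0" for \<omega> e by (simp add: w_def running_max_nonneg)
  have wint: "integrable M (\<lambda>\<omega>. w \<omega> e)" for e
    unfolding w_def using int by (intro Bochner_Integration.integrable_add integrable_running_max) auto
  have wmeas [measurable]: "case_prod w \<in> borel_measurable (M \<Otimes>\<^sub>M \<nu>)"
    unfolding w_def split_beta' by (intro borel_measurable_add borel_measurable_running_max; measurable)
  have per: "ennreal (c * hull_perimeter Z n \<omega>) = (\<integral>\<^sup>+e. ennreal (2 * w \<omega> e) \<partial>\<nu>)" for \<omega>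
    unfolding hull_perimeter_def w_def width_walk[symmetric]
    by (rule perimeter_eq_mean_width[OF _ _ sets_\<nu> c \<nu>]) auto
  have per0: "hull_perimeter Z n \<omega> \<ge> 0" for \<omega>
    unfolding hull_perimeter_def by (intro perimeter_nonneg) auto
  have "(\<lambda>\<omega>. ennreal (c * hull_perimeter Z n \<omega>)) \<in> borel_measurable M"
    unfolding per by measurable
  then have "(\<lambda>\<omega>. enn2real (ennreal (c * hull_perimeter Z n \<omega>))) \<in> borel_measurable M"
    by measurable
  then have pmeas: "(\<lambda>\<omega>. c * hull_perimeter Z n \<omega>) \<in> borel_measurable M"
    using c per0 by simp
  have "(\<integral>\<^sup>+\<omega>. ennreal (c * hull_perimeter Z n \<omega>) \<partial>M) = (\<integral>\<^sup>+\<omega>. \<integral>\<^sup>+e. ennreal (2 * w \<omega> e) \<partial>\<nu> \<partial>M)"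
    unfolding per ..
  also have "\<dots> = (\<integral>\<^sup>+e. \<integral>\<^sup>+\<omega>. ennreal (2 * w \<omega> e) \<partial>M \<partial>\<nu>)"
    by (intro Fubini'[symmetric]) measurable
  also have "\<dots> = (\<integral>\<^sup>+e. (\<Sum>k=1..n. ennreal (2 / real k) * (\<integral>\<^sup>+\<omega>. ennreal \<bar>walk Z k \<omega> \<bullet> e\<bar> \<partial>M)) \<partial>\<nu>)"
  proof (intro nn_integral_cong)
    fix e
    have "(\<integral>\<^sup>+\<omega>. ennreal (2 * w \<omega> e) \<partial>M) = ennreal (expectation (\<lambda>\<omega>. 2 * w \<omega> e))"
      using wint w0 by (intro nn_integral_eq_integral) auto
    also have "expectation (\<lambda>\<omega>. 2 * w \<omega> e) = 2 * (\<Sum>k=1..n. expectation (\<lambda>\<omega>. \<bar>walk Z k \<omega> \<bullet> e\<bar>) / real k)"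
      unfolding w_def by (simp only: integral_mult_right_zero expectation_width[OF indep ident int])
    also have "ennreal \<dots> = (\<Sum>k=1..n. ennreal (2 / real k * expectation (\<lambda>\<omega>. \<bar>walk Z k \<omega> \<bullet> e\<bar>)))"
      by (subst sum_ennreal) (auto simp: sum_distrib_left intro!: integral_nonneg_AE)
    also have "\<dots> = (\<Sum>k=1..n. ennreal (2 / real k) * (\<integral>\<^sup>+\<omega>. ennreal \<bar>walk Z k \<omega> \<bullet> e\<bar> \<partial>M))"
      using int_walk
      by (intro sum.cong refl, subst nn_integral_eq_integral)
        (auto simp: integral_nonneg_AE simp flip: ennreal_mult)
    finally show "(\<integral>\<^sup>+\<omega>. ennreal (2 * w \<omega> e) \<partial>M)
        = (\<Sum>k=1..n. ennreal (2 / real k) * (\<integral>\<^sup>+\<omega>. ennreal \<bar>walk Z k \<omega> \<bullet> e\<bar> \<partial>M))" .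
  qed
  also have "\<dots> = (\<Sum>k=1..n. ennreal (2 / real k) * (\<integral>\<^sup>+e. \<integral>\<^sup>+\<omega>. ennreal \<bar>walk Z k \<omega> \<bullet> e\<bar> \<partial>M \<partial>\<nu>))"
    by (subst nn_integral_sum) (auto intro!: sum.cong nn_integral_cmult)
  also have "\<dots> = (\<Sum>k=1..n. ennreal (2 / real k) * (\<integral>\<^sup>+\<omega>. \<integral>\<^sup>+e. ennreal \<bar>walk Z k \<omega> \<bullet> e\<bar> \<partial>\<nu> \<partial>M))"
    by (intro sum.cong refl arg_cong2[of _ _ _ _ "(*)"] Fubini') measurable
  also have "\<dots> = (\<Sum>k=1..n. ennreal (2 / real k) * ennreal (c * expectation (\<lambda>\<omega>. norm (walk Z k \<omega>))))"
    unfolding \<nu> using int_walk c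
    by (intro sum.cong refl arg_cong2[of _ _ _ _ "(*)"], subst nn_integral_eq_integral) auto
  also have "\<dots> = ennreal (c * (\<Sum>k=1..n. 2 * expectation (\<lambda>\<omega>. norm (walk Z k \<omega>)) / real k))"
    using c by (simp add: ennreal_mult[symmetric] sum_distrib_left integral_nonneg_AE sum_ennreal mult_ac)
  finally have "(\<integral>\<^sup>+\<omega>. ennreal (c * hull_perimeter Z n \<omega>) \<partial>M)
      = ennreal (c * (\<Sum>k=1..n. 2 * expectation (\<lambda>\<omega>. norm (walk Z k \<omega>)) / real k))" .
  then have "expectation (\<lambda>\<omega>. c * hull_perimeter Z n \<omega>)
      = c * (\<Sum>k=1..n. 2 * expectation (\<lambda>\<omega>. norm (walk Z k \<omega>)) / real k)"
    using pmeas c per0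
    by (subst integral_eq_nn_integral)
      (auto intro!: enn2real_ennreal mult_nonneg_nonneg sum_nonneg divide_nonneg_nonneg integral_nonneg_AE)
  then show ?thesis using c by simp
qed

section \<open>Uniform integrability of squared sums\<close>

lemma (in prob_space) indep_partial_sum_next:
  fixes X :: "nat \<Rightarrow> 'a \<Rightarrow> real"
  assumes indep: "indep_vars (\<lambda>_. borel) X UNIV"
    and f: "f \<in> borel_measurable borel" "g \<in> borel_measurable borel"
  shows "indep_var borel (\<lambda>\<omega>. f (X (Suc k) \<omega>)) borel (\<lambda>\<omega>. g (partial_sum (\<lambda>i. X i \<omega>) k))"
proof -
  have "indep_var borel (X (Suc k)) borel (\<lambda>\<omega>. \<Sum>i=1..k. X i \<omega>)"
    by (intro indep_vars_sum indep_vars_subset[OF indep]) auto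
  from indep_var_compose[OF this f] show ?thesis
    by (simp add: o_def partial_sum_def)
qed

lemma (in prob_space) second_moment_partial_sum:
  fixes X :: "nat \<Rightarrow> 'a \<Rightarrow> real"
  assumes indep: "indep_vars (\<lambda>_. borel) X UNIV"
    and ident: "\<And>n. distr M borel (X n) = distr M borel (X 0)"
    and sq: "integrable M (\<lambda>\<omega>. (X 0 \<omega>)\<^sup>2)" and mean: "expectation (X 0) = 0"
  shows "integrable M (\<lambda>\<omega>. (partial_sum (\<lambda>i. X i \<omega>) k)\<^sup>2) \<and>
    expectation (\<lambda>\<omega>. (partial_sum (\<lambda>i. X i \<omega>) k)\<^sup>2) = real k * expectation (\<lambda>\<omega>. (X 0 \<omega>)\<^sup>2)"
proof (induction k)
  case 0
  show ?case by (simp add: partial_sum_def)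
next
  case (Suc k)
  have rv [measurable]: "X i \<in> borel_measurable M" for i
    using indep by (auto simp: indep_vars_def)
  let ?S = "\<lambda>\<omega>. partial_sum (\<lambda>i. X i \<omega>) k" and ?Y = "X (Suc k)"
  have X0: "integrable M (X 0)"
    by (rule square_integrable_imp_integrable[OF rv sq])
  have Y2: "integrable M (\<lambda>\<omega>. (?Y \<omega>)\<^sup>2)" "expectation (\<lambda>\<omega>. (?Y \<omega>)\<^sup>2) = expectation (\<lambda>\<omega>. (X 0 \<omega>)\<^sup>2)"
    using ident_expectation[OF ident[of "Suc k"] rv rv, of "\<lambda>x. x\<^sup>2"] sq by simp_all
  have Y1: "integrable M ?Y" "expectation ?Y = 0"
    using ident_expectation[OF ident[of "Suc k"] rv rv, of "\<lambda>x. x"] X0 mean by simp_all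
  have S: "integrable M ?S"
    by (rule square_integrable_imp_integrable[OF _ conjunct1[OF Suc.IH]]) measurable
  have ind: "indep_var borel ?Y borel ?S"
    using indep_partial_sum_next[OF indep, of "\<lambda>x. x" "\<lambda>x. x"] by simp
  have SY: "integrable M (\<lambda>\<omega>. ?Y \<omega> * ?S \<omega>)" "expectation (\<lambda>\<omega>. ?Y \<omega> * ?S \<omega>) = 0"
    using indep_var_integrable[OF ind Y1(1) S] indep_var_lebesgue_integral[OF ind Y1(1) S] Y1(2)
    by simp_all
  have eq: "(partial_sum (\<lambda>i. X i \<omega>) (Suc k))\<^sup>2 = (?S \<omega>)\<^sup>2 + 2 * (?Y \<omega> * ?S \<omega>) + (?Y \<omega>)\<^sup>2" for \<omega>
    unfolding partial_sum_Suc by algebra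
  show ?case unfolding eq using Suc.IH Y2 SY by (simp add: distrib_right)
qed

text \<open>The bound is quadratic in \<open>k\<close>, because in the expansion of the fourth power every term that contains
  some increment exactly once has expectation zero, and what remains are fourth powers and products of two
  squares. For bounded increments it makes \<open>S\<^sub>k\<^sup>2 / k\<close> bounded in mean square, hence uniformly integrable.\<close>

lemma (in prob_space) fourth_moment_partial_sum:
  fixes X :: "nat \<Rightarrow> 'a \<Rightarrow> real"
  assumes indep: "indep_vars (\<lambda>_. borel) X UNIV"
    and ident: "\<And>n. distr M borel (X n) = distr M borel (X 0)"
    and bdd: "\<And>i \<omega>. \<bar>X i \<omega>\<bar> \<le> b" and mean: "expectation (X 0) = 0"
  shows "integrable M (\<lambda>\<omega>. (partial_sum (\<lambda>i. X i \<omega>) k) ^ 4)"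
    "expectation (\<lambda>\<omega>. (partial_sum (\<lambda>i. X i \<omega>) k) ^ 4) \<le> 3 * b ^ 4 * (real k)\<^sup>2"
proof -
  have rv [measurable]: "X i \<in> borel_measurable M" for i
    using indep by (auto simp: indep_vars_def)
  have b0: "b \<ge> 0" using bdd[of 0 undefined] by linarith
  have bound: "\<bar>partial_sum (\<lambda>i. X i \<omega>) k\<bar> \<le> real k * b" for k \<omega>
  proof -
    have "\<bar>partial_sum (\<lambda>i. X i \<omega>) k\<bar> \<le> (\<Sum>i=1..k. \<bar>X i \<omega>\<bar>)"
      unfolding partial_sum_def by (rule sum_abs)
    also have "\<dots> \<le> of_nat (card {1..k}) * b"
      using bdd by (intro sum_bounded_above) auto
    finally show ?thesis by simp
  qed
  have intS: "integrable M (\<lambda>\<omega>. (partial_sum (\<lambda>i. X i \<omega>) k) ^ j)" for j k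
    using bound power_mono[OF bound abs_ge_zero]
    by (intro integrable_const_bound[of _ "(real k * b) ^ j"]) (auto simp: power_abs)
  have intX: "integrable M (\<lambda>\<omega>. X i \<omega> ^ j)" for i j
    using power_mono[OF bdd abs_ge_zero]
    by (intro integrable_const_bound[of _ "b ^ j"]) (auto simp: power_abs)
  show "integrable M (\<lambda>\<omega>. (partial_sum (\<lambda>i. X i \<omega>) k) ^ 4)" by (rule intS)
  have mom: "expectation (\<lambda>\<omega>. X i \<omega> ^ j) \<le> b ^ j" for i j
  proof -
    have "X i \<omega> ^ j \<le> b ^ j" for \<omega>
      using power_mono[OF bdd abs_ge_zero, of i \<omega> j] by (simp add: power_abs[symmetric] abs_le_iff)
    then show ?thesis
      using integral_mono[OF intX[of i j], of "\<lambda>_. b ^ j"] by (simp add: prob_space)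
  qed
  show "expectation (\<lambda>\<omega>. (partial_sum (\<lambda>i. X i \<omega>) k) ^ 4) \<le> 3 * b ^ 4 * (real k)\<^sup>2"
  proof (induction k)
    case 0
    show ?case by (simp add: partial_sum_def)
  next
    case (Suc k)
    let ?S = "\<lambda>\<omega>. partial_sum (\<lambda>i. X i \<omega>) k" and ?Y = "X (Suc k)"
    have ind: "indep_var borel (\<lambda>\<omega>. ?Y \<omega> ^ j) borel (\<lambda>\<omega>. ?S \<omega> ^ i)" for i j
      by (intro indep_partial_sum_next[OF indep]) auto
    have prod: "integrable M (\<lambda>\<omega>. ?S \<omega> ^ i * ?Y \<omega> ^ j)"
      "expectation (\<lambda>\<omega>. ?S \<omega> ^ i * ?Y \<omega> ^ j) = expectation (\<lambda>\<omega>. ?S \<omega> ^ i) * expectation (\<lambda>\<omega>. ?Y \<omega> ^ j)" for i j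
      using indep_var_integrable[OF ind intX intS] indep_var_lebesgue_integral[OF ind intX intS]
      by (simp_all add: mult.commute)
    have sq: "integrable M (\<lambda>\<omega>. (X 0 \<omega>)\<^sup>2)" by (rule intX)
    have mean': "expectation (X i) = 0" for i
      using ident_expectation(1)[OF ident[of i] rv rv, of "\<lambda>x. x"] mean by simp
    have S1: "expectation ?S = 0"
      using intX[of _ 1] mean' by (simp add: partial_sum_def)
    have S2: "expectation (\<lambda>\<omega>. (?S \<omega>)\<^sup>2) \<le> real k * b\<^sup>2"
      using second_moment_partial_sum[OF indep ident sq mean, of k] mom[of 0 2] by (simp add: mult_left_mono)
    have SY: "expectation (\<lambda>\<omega>. (?S \<omega>)\<^sup>2) * expectation (\<lambda>\<omega>. (?Y \<omega>)\<^sup>2) \<le> (real k * b\<^sup>2) * b\<^sup>2"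
      using S2 mom[of "Suc k" 2] by (intro mult_mono) auto
    have eq: "(partial_sum (\<lambda>i. X i \<omega>) (Suc k)) ^ 4 = ?S \<omega> ^ 4 + 4 * (?S \<omega> ^ 3 * ?Y \<omega> ^ 1)
        + 6 * (?S \<omega> ^ 2 * ?Y \<omega> ^ 2) + 4 * (?S \<omega> ^ 1 * ?Y \<omega> ^ 3) + ?Y \<omega> ^ 4" for \<omega>
      unfolding partial_sum_Suc power_one_right by algebra
    have "expectation (\<lambda>\<omega>. (partial_sum (\<lambda>i. X i \<omega>) (Suc k)) ^ 4) = expectation (\<lambda>\<omega>. ?S \<omega> ^ 4)
        + 4 * expectation (\<lambda>\<omega>. ?S \<omega> ^ 3 * ?Y \<omega> ^ 1) + 6 * expectation (\<lambda>\<omega>. ?S \<omega> ^ 2 * ?Y \<omega> ^ 2)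
        + 4 * expectation (\<lambda>\<omega>. ?S \<omega> ^ 1 * ?Y \<omega> ^ 3) + expectation (\<lambda>\<omega>. ?Y \<omega> ^ 4)"
      unfolding eq using prod(1) intS[of k 4] intX[of "Suc k" 4]
      by (simp only: Bochner_Integration.integral_add Bochner_Integration.integrable_add
          integrable_mult_right integral_mult_right_zero)
    also have "\<dots> \<le> 3 * b ^ 4 * (real k)\<^sup>2 + 6 * ((real k * b\<^sup>2) * b\<^sup>2) + b ^ 4"
      using Suc SY mom[of "Suc k" 4] unfolding prod(2) by (simp add: mean' S1)
    also have "\<dots> \<le> 3 * b ^ 4 * (real (Suc k))\<^sup>2"
      using b0 by (simp add: power2_eq_square power4_eq_xxxx algebra_simps)
    finally show ?case .
  qed
qed

lemma (in prob_space) truncation_second_moment: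
  fixes X :: "'a \<Rightarrow> real"
  assumes [measurable]: "X \<in> borel_measurable M" and sq: "integrable M (\<lambda>\<omega>. (X \<omega>)\<^sup>2)" and \<epsilon>: "\<epsilon> > 0"
  obtains B where "B > 0" "expectation (\<lambda>\<omega>. (if \<bar>X \<omega>\<bar> \<le> B then 0 else X \<omega>)\<^sup>2) \<le> \<epsilon>"
proof -
  have "(\<lambda>n. expectation (\<lambda>\<omega>. (if \<bar>X \<omega>\<bar> \<le> real n then 0 else X \<omega>)\<^sup>2)) \<longlonglongrightarrow> expectation (\<lambda>\<omega>. 0)"
  proof (rule integral_dominated_convergence[where w = "\<lambda>\<omega>. (X \<omega>)\<^sup>2"])
    show "AE \<omega> in M. (\<lambda>n. (if \<bar>X \<omega>\<bar> \<le> real n then 0 else X \<omega>)\<^sup>2) \<longlonglongrightarrow> 0"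
    proof (intro AE_I2 tendsto_eventually)
      fix \<omega>
      show "\<forall>\<^sub>F n in sequentially. (if \<bar>X \<omega>\<bar> \<le> real n then 0 else X \<omega>)\<^sup>2 = 0"
        using eventually_ge_at_top[of "nat \<lceil>\<bar>X \<omega>\<bar>\<rceil>"]
        by eventually_elim (use real_nat_ceiling_ge[of "\<bar>X \<omega>\<bar>"] in auto)
    qed
  qed (use sq in auto)
  then have "\<forall>\<^sub>F n in sequentially. expectation (\<lambda>\<omega>. (if \<bar>X \<omega>\<bar> \<le> real n then 0 else X \<omega>)\<^sup>2) < \<epsilon>"
    using \<epsilon> by (intro order_tendstoD(2)) auto
  then have "\<forall>\<^sub>F n in sequentially. real n > 0 \<and>
      expectation (\<lambda>\<omega>. (if \<bar>X \<omega>\<bar> \<le> real n then 0 else X \<omega>)\<^sup>2) \<le> \<epsilon>"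
    using eventually_gt_at_top[of 0] by eventually_elim auto
  then obtain n where "real n > 0" "expectation (\<lambda>\<omega>. (if \<bar>X \<omega>\<bar> \<le> real n then 0 else X \<omega>)\<^sup>2) \<le> \<epsilon>"
    using eventually_happens'[OF sequentially_bot] by blast
  then show thesis using that by blast
qed

text \<open>This is the inequality \<open>2 * y \<le> s * y\<^sup>2 + 1 / s\<close> with \<open>y = S\<^sup>2\<close>, on the event \<open>A\<close>. With the free
  parameter \<open>s\<close> it replaces the Cauchy--Schwarz inequality.\<close>

lemma (in prob_space) second_moment_on_event_le_fourth:
  fixes S :: "'a \<Rightarrow> real"
  assumes A: "A \<in> events" and S: "integrable M (\<lambda>\<omega>. S \<omega> ^ 4)" and [measurable]: "S \<in> borel_measurable M"
    and s: "s > 0"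
  shows "integrable M (\<lambda>\<omega>. (S \<omega>)\<^sup>2 * indicator A \<omega>)"
    "expectation (\<lambda>\<omega>. (S \<omega>)\<^sup>2 * indicator A \<omega>) \<le> (s * expectation (\<lambda>\<omega>. S \<omega> ^ 4) + prob A / s) / 2"
proof -
  note A[measurable]
  have pt: "(S \<omega>)\<^sup>2 * indicator A \<omega> \<le> (s * S \<omega> ^ 4 + indicator A \<omega> / s) / 2" for \<omega>
  proof -
    have "0 \<le> (s * (S \<omega>)\<^sup>2 - 1)\<^sup>2 / s" using s by simp
    also have "\<dots> = s * S \<omega> ^ 4 - 2 * (S \<omega>)\<^sup>2 + 1 / s"
      using s by (simp add: field_simps power2_eq_square power4_eq_xxxx)
    finally show ?thesis using s by (auto simp: indicator_def)
  qed
  have int: "integrable M (\<lambda>\<omega>. (s * S \<omega> ^ 4 + indicator A \<omega> / s) / 2)"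
    using S A by (intro integrable_divide Bochner_Integration.integrable_add integrable_mult_right
      integrable_real_indicator) (auto simp: emeasure_eq_measure)
  show int2: "integrable M (\<lambda>\<omega>. (S \<omega>)\<^sup>2 * indicator A \<omega>)"
  proof (rule Bochner_Integration.integrable_bound[OF int])
    show "AE \<omega> in M. norm ((S \<omega>)\<^sup>2 * indicator A \<omega>) \<le> norm ((s * S \<omega> ^ 4 + indicator A \<omega> / s) / 2)"
    proof (rule AE_I2)
      fix \<omega>
      have "0 \<le> (S \<omega>)\<^sup>2 * indicator A \<omega>" by simp
      then show "norm ((S \<omega>)\<^sup>2 * indicator A \<omega>) \<le> norm ((s * S \<omega> ^ 4 + indicator A \<omega> / s) / 2)"
        using pt[of \<omega>] by (metis abs_of_nonneg order_trans real_norm_def)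
    qed
  qed measurable
  have "expectation (\<lambda>\<omega>. (S \<omega>)\<^sup>2 * indicator A \<omega>) \<le> expectation (\<lambda>\<omega>. (s * S \<omega> ^ 4 + indicator A \<omega> / s) / 2)"
    by (intro integral_mono int int2 pt)
  also have "\<dots> = (s * expectation (\<lambda>\<omega>. S \<omega> ^ 4) + prob A / s) / 2"
    using S A by (simp add: emeasure_eq_measure)
  finally show "expectation (\<lambda>\<omega>. (S \<omega>)\<^sup>2 * indicator A \<omega>) \<le> (s * expectation (\<lambda>\<omega>. S \<omega> ^ 4) + prob A / s) / 2" .
qed

text \<open>Uniform integrability of \<open>S\<^sub>k\<^sup>2 / k\<close>, stated in terms of events of small probability. The
  increments are split into a centred bounded part \<open>Y\<close> and a centred remainder \<open>R\<close> of small
  variance. The sums of \<open>R\<close> are small in mean square, on any event, and for the sums of \<open>Y\<close> the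
  fourth moment is under control.\<close>

lemma (in prob_space) partial_sum_square_uniformly_integrable:
  fixes X :: "nat \<Rightarrow> 'a \<Rightarrow> real"
  assumes indep: "indep_vars (\<lambda>_. borel) X UNIV"
    and ident: "\<And>n. distr M borel (X n) = distr M borel (X 0)"
    and sq: "integrable M (\<lambda>\<omega>. (X 0 \<omega>)\<^sup>2)" and mean: "expectation (X 0) = 0" and \<epsilon>: "\<epsilon> > 0"
  obtains \<delta> where "\<delta> > 0"
    "\<And>k A. A \<in> events \<Longrightarrow> prob A \<le> \<delta> \<Longrightarrow>
      expectation (\<lambda>\<omega>. (partial_sum (\<lambda>i. X i \<omega>) k)\<^sup>2 * indicator A \<omega>) \<le> \<epsilon> * real k"
proof -
  have rv [measurable]: "X i \<in> borel_measurable M" for i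
    using indep by (auto simp: indep_vars_def)
  have X0: "integrable M (X 0)"
    by (rule square_integrable_imp_integrable[OF rv sq])
  obtain B where B: "B > 0" and tail: "expectation (\<lambda>\<omega>. (if \<bar>X 0 \<omega>\<bar> \<le> B then 0 else X 0 \<omega>)\<^sup>2) \<le> \<epsilon> / 4"
    using truncation_second_moment[OF rv sq, of "\<epsilon> / 4"] \<epsilon> by auto
  define T where "T = (\<lambda>x::real. if \<bar>x\<bar> \<le> B then x else 0)"
  define U where "U = (\<lambda>x::real. if \<bar>x\<bar> \<le> B then 0 else x)"
  have [measurable]: "T \<in> borel_measurable borel" "U \<in> borel_measurable borel"
    unfolding T_def U_def by measurable
  have TU: "x = T x + U x" for x by (simp add: T_def U_def)
  have T_le: "\<bar>T x\<bar> \<le> B" for x using B by (simp add: T_def)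
  have U_le: "\<bar>U x\<bar> \<le> \<bar>x\<bar>" "(U x)\<^sup>2 \<le> x\<^sup>2" for x by (auto simp: U_def)
  have intT: "integrable M (\<lambda>\<omega>. T (X 0 \<omega>))"
    by (intro integrable_const_bound[of _ B]) (auto simp: T_le)
  have intU: "integrable M (\<lambda>\<omega>. U (X 0 \<omega>))"
    by (rule Bochner_Integration.integrable_bound[OF X0]) (auto simp: U_le)
  have intU2: "integrable M (\<lambda>\<omega>. (U (X 0 \<omega>))\<^sup>2)"
    by (rule Bochner_Integration.integrable_bound[OF sq]) (auto simp: U_le)
  \<comment> \<open>The truncated variable need not be centred, so its mean is moved from one part to the other.\<close>
  define m where "m = expectation (\<lambda>\<omega>. T (X 0 \<omega>))"
  have "expectation (X 0) = expectation (\<lambda>\<omega>. T (X 0 \<omega>) + U (X 0 \<omega>))"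
    by (simp flip: TU)
  then have mU: "expectation (\<lambda>\<omega>. U (X 0 \<omega>)) = - m"
    using intT intU mean by (simp add: m_def)
  have m_le: "\<bar>m\<bar> \<le> B"
  proof -
    have "\<bar>m\<bar> \<le> expectation (\<lambda>\<omega>. \<bar>T (X 0 \<omega>)\<bar>)"
      unfolding m_def by (rule integral_abs_bound)
    also have "\<dots> \<le> expectation (\<lambda>_. B)"
      using intT T_le by (intro integral_mono) auto
    finally show ?thesis by (simp add: prob_space)
  qed
  define Y where "Y = (\<lambda>i \<omega>. T (X i \<omega>) - m)"
  define R where "R = (\<lambda>i \<omega>. U (X i \<omega>) + m)"
  have Y: "indep_vars (\<lambda>_. borel) Y UNIV" "\<And>i. distr M borel (Y i) = distr M borel (Y 0)"
    unfolding Y_def using iid_compose[OF indep ident, of "\<lambda>x. T x - m"] by auto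
  have R: "indep_vars (\<lambda>_. borel) R UNIV" "\<And>i. distr M borel (R i) = distr M borel (R 0)"
    unfolding R_def using iid_compose[OF indep ident, of "\<lambda>x. U x + m"] by auto
  have Ymean: "expectation (Y 0) = 0"
    using intT by (simp add: Y_def m_def prob_space)
  have Rmean: "expectation (R 0) = 0"
    using intU mU by (simp add: R_def prob_space)
  have Ybd: "\<bar>Y i \<omega>\<bar> \<le> 2 * B" for i \<omega>
    using T_le[of "X i \<omega>"] m_le unfolding Y_def by linarith
  have R2eq: "(R 0 \<omega>)\<^sup>2 = (U (X 0 \<omega>))\<^sup>2 + 2 * m * U (X 0 \<omega>) + m\<^sup>2" for \<omega>
    unfolding R_def by algebra
  have Rsq: "integrable M (\<lambda>\<omega>. (R 0 \<omega>)\<^sup>2)"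
    unfolding R2eq using intU intU2 by auto
  have "expectation (\<lambda>\<omega>. (R 0 \<omega>)\<^sup>2) = expectation (\<lambda>\<omega>. (U (X 0 \<omega>))\<^sup>2) - m\<^sup>2"
    unfolding R2eq using intU intU2 mU by (simp add: prob_space power2_eq_square)
  then have Rvar: "expectation (\<lambda>\<omega>. (R 0 \<omega>)\<^sup>2) \<le> \<epsilon> / 4"
    using tail zero_le_power2[of m] unfolding U_def by linarith
  define b where "b = 2 * B"
  \<comment> \<open>With this weight the two terms of the bound by the fourth moment are equal.\<close>
  define \<sigma> where "\<sigma> = \<epsilon> / (12 * b ^ 4)"
  have \<sigma>: "\<sigma> > 0" using \<epsilon> B by (simp add: \<sigma>_def b_def)
  show thesis
  proof (rule that)
    show "\<sigma> * \<epsilon> / 4 > 0" using \<sigma> \<epsilon> by simp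
    fix k A assume A: "A \<in> events" and PA: "prob A \<le> \<sigma> * \<epsilon> / 4"
    let ?X = "\<lambda>\<omega>. partial_sum (\<lambda>i. X i \<omega>) k" and ?Y = "\<lambda>\<omega>. partial_sum (\<lambda>i. Y i \<omega>) k"
      and ?R = "\<lambda>\<omega>. partial_sum (\<lambda>i. R i \<omega>) k"
    show "expectation (\<lambda>\<omega>. (?X \<omega>)\<^sup>2 * indicator A \<omega>) \<le> \<epsilon> * real k"
    proof (cases "k = 0")
      case True
      then show ?thesis by (simp add: partial_sum_def)
    next
      case False
      then have k: "real k > 0" by simp
      have [measurable]: "Y i \<in> borel_measurable M" "R i \<in> borel_measurable M" for i
        using Y(1) R(1) by (auto simp: indep_vars_def)
      have Y4: "integrable M (\<lambda>\<omega>. ?Y \<omega> ^ 4)" "expectation (\<lambda>\<omega>. ?Y \<omega> ^ 4) \<le> 3 * b ^ 4 * (real k)\<^sup>2"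
        using fourth_moment_partial_sum[OF Y _ Ymean, of b k] Ybd by (simp_all add: b_def)
      have R2: "integrable M (\<lambda>\<omega>. (?R \<omega>)\<^sup>2)" "expectation (\<lambda>\<omega>. (?R \<omega>)\<^sup>2) = real k * expectation (\<lambda>\<omega>. (R 0 \<omega>)\<^sup>2)"
        using second_moment_partial_sum[OF R Rsq Rmean, of k] by auto
      have s: "\<sigma> / real k > 0" using \<sigma> k by simp
      have Ym [measurable]: "?Y \<in> borel_measurable M" by measurable
      note YA = second_moment_on_event_le_fourth[OF A Y4(1) Ym s]
      have X2: "integrable M (\<lambda>\<omega>. (?X \<omega>)\<^sup>2)"
        using second_moment_partial_sum[OF indep ident sq mean, of k] by auto
      have "expectation (\<lambda>\<omega>. (?Y \<omega>)\<^sup>2 * indicator A \<omega>)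
          \<le> (\<sigma> / real k * expectation (\<lambda>\<omega>. ?Y \<omega> ^ 4) + prob A / (\<sigma> / real k)) / 2"
        by (rule YA)
      also have "\<dots> \<le> (\<sigma> / real k * (3 * b ^ 4 * (real k)\<^sup>2) + (\<sigma> * \<epsilon> / 4) / (\<sigma> / real k)) / 2"
        using s Y4 PA by (intro divide_right_mono add_mono mult_left_mono) auto
      also have "\<dots> = \<epsilon> / 4 * real k"
        using k \<sigma> B by (simp add: \<sigma>_def b_def field_simps power2_eq_square)
      finally have YA2: "expectation (\<lambda>\<omega>. (?Y \<omega>)\<^sup>2 * indicator A \<omega>) \<le> \<epsilon> / 4 * real k" .
      have XYR: "?X \<omega> = ?Y \<omega> + ?R \<omega>" for \<omega>
        unfolding partial_sum_def Y_def R_def sum.distrib[symmetric] using TU by (intro sum.cong) auto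
      have pt: "(?X \<omega>)\<^sup>2 * indicator A \<omega> \<le> 2 * ((?Y \<omega>)\<^sup>2 * indicator A \<omega>) + 2 * (?R \<omega>)\<^sup>2" for \<omega>
      proof -
        have "(y + r)\<^sup>2 \<le> 2 * y\<^sup>2 + 2 * r\<^sup>2" for y r :: real
          using zero_le_power2[of "y - r"] by (simp add: power2_eq_square algebra_simps)
        then show ?thesis unfolding XYR by (simp add: indicator_def)
      qed
      have "expectation (\<lambda>\<omega>. (?X \<omega>)\<^sup>2 * indicator A \<omega>)
          \<le> expectation (\<lambda>\<omega>. 2 * ((?Y \<omega>)\<^sup>2 * indicator A \<omega>) + 2 * (?R \<omega>)\<^sup>2)"
        using X2 YA(1) R2(1) A pt by (intro integral_mono integrable_real_mult_indicator) auto
      also have "\<dots> = 2 * expectation (\<lambda>\<omega>. (?Y \<omega>)\<^sup>2 * indicator A \<omega>) + 2 * expectation (\<lambda>\<omega>. (?R \<omega>)\<^sup>2)"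
        using YA(1) R2(1) by simp
      also have "\<dots> \<le> 2 * (\<epsilon> / 4 * real k) + 2 * (real k * (\<epsilon> / 4))"
        using YA2 Rvar unfolding R2(2)
        by (intro add_mono mult_left_mono) auto
      finally show ?thesis by (simp add: algebra_simps)
    qed
  qed
qed

section \<open>The expected distance from the origin\<close>

text \<open>The product of \<open>\<parallel>x\<parallel> - x \<bullet> u\<close> and \<open>\<parallel>x\<parallel> + x \<bullet> u\<close> is the squared norm of the part of \<open>d\<close>
  perpendicular to \<open>u\<close>. For small \<open>d\<close> the second factor is \<open>2 * m * k\<close> up to a relative error of
  order \<open>\<eta> / m\<close>. For large \<open>d\<close> the crude bound \<open>2 * \<parallel>d\<parallel>\<close> on the first factor is enough, as \<open>\<parallel>d\<parallel>\<close> is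
  then at most \<open>\<parallel>d\<parallel>\<^sup>2 / (\<eta> * k)\<close>.\<close>

lemma norm_minus_projection_estimate:
  fixes d u x :: "'a::real_inner"
  assumes u: "norm u = 1" and m: "m > 0" and k: "k > 0" and \<eta>: "\<eta> > 0" "\<eta> \<le> m / 2"
    and x: "x = (k * m) *\<^sub>R u + d"
  shows "\<bar>norm x - x \<bullet> u - ((norm d)\<^sup>2 - (d \<bullet> u)\<^sup>2) / (2 * m * k)\<bar>
    \<le> \<eta> / m\<^sup>2 * ((norm d)\<^sup>2 / k)
      + (2 / \<eta> + 1 / (2 * m)) * ((norm d)\<^sup>2 * (if norm d > \<eta> * k then 1 else 0) / k)"
proof -
  let ?N = "norm x" and ?T = "x \<bullet> u" and ?w = "(norm d)\<^sup>2 - (d \<bullet> u)\<^sup>2"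
  have uu: "u \<bullet> u = 1" using u by (simp add: dot_square_norm)
  have du: "\<bar>d \<bullet> u\<bar> \<le> norm d" using Cauchy_Schwarz_ineq2[of d u] u by simp
  have T: "?T = k * m + d \<bullet> u" by (simp add: x inner_simps uu)
  have km: "norm ((k * m) *\<^sub>R u) = k * m" using u m k by simp
  have N: "?N \<le> k * m + norm d" "k * m - norm d \<le> ?N"
    using norm_triangle_ineq[of "(k * m) *\<^sub>R u" d] norm_diff_ineq[of "(k * m) *\<^sub>R u" d] km x
    by auto
  have NT: "?T \<le> ?N" using Cauchy_Schwarz_ineq2[of x u] u by simp
  have w0: "0 \<le> ?w" using power_mono[OF du, of 2] by simp
  have wq: "?w \<le> (norm d)\<^sup>2" by simp
  have "?N\<^sup>2 = (k * m)\<^sup>2 + 2 * (k * m) * (d \<bullet> u) + (norm d)\<^sup>2"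
    unfolding power2_norm_eq_inner by (simp add: x inner_simps uu inner_commute power2_eq_square algebra_simps)
  then have prod: "(?N - ?T) * (?N + ?T) = ?w"
    unfolding T by (simp add: power2_eq_square algebra_simps)
  show ?thesis
  proof (cases "norm d > \<eta> * k")
    case False
    define s where "s = ?N + ?T"
    have s: "\<bar>2 * m * k - s\<bar> \<le> 2 * (\<eta> * k)"
      using False N T du by (simp add: s_def algebra_simps abs_le_iff)
    have "\<eta> * k \<le> m / 2 * k" using \<eta> k by (intro mult_right_mono) auto
    with s have sk: "k * m \<le> s" by (simp add: abs_le_iff algebra_simps)
    then have s0: "s > 0" using k m by (meson less_le_trans mult_pos_pos)
    have "?N - ?T - ?w / (2 * m * k) = ?w * (2 * m * k - s) / (s * (2 * m * k))"
    proof -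
      have "?N - ?T = ?w / s" using prod s0 by (simp add: s_def field_simps)
      then show ?thesis using s0 m k by (simp add: diff_frac_eq right_diff_distrib)
    qed
    then have "\<bar>?N - ?T - ?w / (2 * m * k)\<bar> = ?w * \<bar>2 * m * k - s\<bar> / (s * (2 * m * k))"
      using w0 s0 m k by (simp add: abs_mult)
    also have "\<dots> \<le> (norm d)\<^sup>2 * (2 * (\<eta> * k)) / ((k * m) * (2 * m * k))"
      using s sk s0 wq w0 k m \<eta> by (intro frac_le mult_mono) auto
    also have "\<dots> = \<eta> / m\<^sup>2 * ((norm d)\<^sup>2 / k)"
      using k m by (simp add: power2_eq_square mult_ac)
    finally show ?thesis using False by simp
  next
    case True
    have "norm d * (\<eta> * k) \<le> norm d * norm d"
      using True by (intro mult_left_mono) auto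
    then have "norm d \<le> (norm d)\<^sup>2 / (\<eta> * k)"
      using \<eta> k by (simp add: pos_le_divide_eq power2_eq_square)
    then have "?N - ?T \<le> 2 * ((norm d)\<^sup>2 / (\<eta> * k))"
      using N T du by linarith
    moreover have "?w / (2 * m * k) \<le> (norm d)\<^sup>2 / (2 * m * k)"
      using wq m k by (intro divide_right_mono) auto
    moreover have "0 \<le> ?w / (2 * m * k)" using w0 m k by simp
    ultimately have "\<bar>?N - ?T - ?w / (2 * m * k)\<bar>
        \<le> 2 * ((norm d)\<^sup>2 / (\<eta> * k)) + (norm d)\<^sup>2 / (2 * m * k)"
      using NT by linarith
    also have "\<dots> = (2 / \<eta> + 1 / (2 * m)) * ((norm d)\<^sup>2 / k)"
      using \<eta> m k by (simp add: field_simps)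
    finally show ?thesis using True \<eta> m k by (simp add: add_increasing)
  qed
qed

lemma partial_sum_centred_inner: "partial_sum (\<lambda>i. (Z i \<omega> - \<mu>) \<bullet> a) k = (walk Z k \<omega> - real k *\<^sub>R \<mu>) \<bullet> a"
  by (simp add: partial_sum_def walk_def inner_diff_left sum_subtractf inner_sum_left)

lemma norm_sq_vec2: "(norm v)\<^sup>2 = (v \<bullet> axis 1 1)\<^sup>2 + (v \<bullet> axis 2 1)\<^sup>2" for v :: "real^2"
proof -
  have "v \<bullet> v = (v $ 1)\<^sup>2 + (v $ 2)\<^sup>2"
    by (simp add: inner_vec_def sum_2 power2_eq_square)
  then show ?thesis by (simp add: power2_norm_eq_inner inner_axis)
qed

lemma (in prob_space) centred_square_integrable:
  fixes X :: "'a \<Rightarrow> real^2"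
  assumes [measurable]: "X \<in> borel_measurable M" and sq: "integrable M (\<lambda>\<omega>. (norm (X \<omega>))\<^sup>2)"
  shows "integrable M X" "integrable M (\<lambda>\<omega>. (norm (X \<omega> - v))\<^sup>2)"
    "integrable M (\<lambda>\<omega>. ((X \<omega> - v) \<bullet> a)\<^sup>2)"
proof -
  have "integrable M (\<lambda>\<omega>. norm (X \<omega>))"
    by (rule square_integrable_imp_integrable[OF _ sq]) measurable
  then show X: "integrable M X" by (subst (asm) integrable_norm_iff) auto
  have eq: "(norm (X \<omega> - v))\<^sup>2 = (norm (X \<omega>))\<^sup>2 - 2 * (X \<omega> \<bullet> v) + (norm v)\<^sup>2" for \<omega>
    by (simp add: power2_norm_eq_inner inner_simps inner_commute)
  show int: "integrable M (\<lambda>\<omega>. (norm (X \<omega> - v))\<^sup>2)"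
    unfolding eq using sq X by auto
  show "integrable M (\<lambda>\<omega>. ((X \<omega> - v) \<bullet> a)\<^sup>2)"
  proof (rule Bochner_Integration.integrable_bound)
    show "integrable M (\<lambda>\<omega>. (norm (X \<omega> - v))\<^sup>2 * (norm a)\<^sup>2)" using int by simp
    have "((X \<omega> - v) \<bullet> a)\<^sup>2 \<le> (norm (X \<omega> - v))\<^sup>2 * (norm a)\<^sup>2" for \<omega>
      using power_mono[OF Cauchy_Schwarz_ineq2[of "X \<omega> - v" a], of 2] by (simp add: power_mult_distrib)
    then show "AE \<omega> in M. norm (((X \<omega> - v) \<bullet> a)\<^sup>2) \<le> norm ((norm (X \<omega> - v))\<^sup>2 * (norm a)\<^sup>2)"
      by simp
  qed measurable
qed

text \<open>All statements are about inner products with fixed vectors, which are centred one-dimensional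
  walks; for the norm the two coordinates are added.\<close>

lemma (in prob_space) centred_walk_moments:
  fixes Z :: "nat \<Rightarrow> 'a \<Rightarrow> real^2"
  assumes indep: "indep_vars (\<lambda>_. borel) Z UNIV"
    and ident: "\<And>n. distr M borel (Z n) = distr M borel (Z 0)"
    and sq: "integrable M (\<lambda>\<omega>. (norm (Z 0 \<omega>))\<^sup>2)"
  defines "\<mu> \<equiv> mean M (Z 0)"
  defines "d \<equiv> \<lambda>k \<omega>. walk Z k \<omega> - real k *\<^sub>R \<mu>"
  shows "integrable M (\<lambda>\<omega>. (d k \<omega> \<bullet> a)\<^sup>2)"
    "expectation (\<lambda>\<omega>. (d k \<omega> \<bullet> a)\<^sup>2) = real k * expectation (\<lambda>\<omega>. ((Z 0 \<omega> - \<mu>) \<bullet> a)\<^sup>2)"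
    "integrable M (\<lambda>\<omega>. (norm (d k \<omega>))\<^sup>2)"
    "expectation (\<lambda>\<omega>. (norm (d k \<omega>))\<^sup>2) = real k * total_var M (Z 0)"
    "\<epsilon> > 0 \<Longrightarrow> \<exists>\<delta>>0. \<forall>k. \<forall>A\<in>events. prob A \<le> \<delta> \<longrightarrow>
      expectation (\<lambda>\<omega>. (norm (d k \<omega>))\<^sup>2 * indicator A \<omega>) \<le> \<epsilon> * real k"
proof -
  have rv [measurable]: "Z i \<in> borel_measurable M" for i
    using indep by (auto simp: indep_vars_def)
  note Z0 = centred_square_integrable[OF rv sq]
  have X: "indep_vars (\<lambda>_. borel) (\<lambda>i \<omega>. (Z i \<omega> - \<mu>) \<bullet> a) UNIV"
    "distr M borel (\<lambda>\<omega>. (Z i \<omega> - \<mu>) \<bullet> a) = distr M borel (\<lambda>\<omega>. (Z 0 \<omega> - \<mu>) \<bullet> a)"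
    "integrable M (\<lambda>\<omega>. ((Z 0 \<omega> - \<mu>) \<bullet> a)\<^sup>2)" "expectation (\<lambda>\<omega>. (Z 0 \<omega> - \<mu>) \<bullet> a) = 0" for a i
  proof -
    show "indep_vars (\<lambda>_. borel) (\<lambda>i \<omega>. (Z i \<omega> - \<mu>) \<bullet> a) UNIV"
      "distr M borel (\<lambda>\<omega>. (Z i \<omega> - \<mu>) \<bullet> a) = distr M borel (\<lambda>\<omega>. (Z 0 \<omega> - \<mu>) \<bullet> a)"
      using iid_compose[OF indep ident, of "\<lambda>z. (z - \<mu>) \<bullet> a"] by auto
    show "integrable M (\<lambda>\<omega>. ((Z 0 \<omega> - \<mu>) \<bullet> a)\<^sup>2)" by (rule Z0)
    have "expectation (\<lambda>\<omega>. (Z 0 \<omega> - \<mu>) \<bullet> a) = expectation (\<lambda>\<omega>. Z 0 \<omega> - \<mu>) \<bullet> a"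
      using Z0(1) by (intro integral_inner_left) auto
    also have "expectation (\<lambda>\<omega>. Z 0 \<omega> - \<mu>) = 0"
      using Z0(1) by (simp add: \<mu>_def mean_def prob_space)
    finally show "expectation (\<lambda>\<omega>. (Z 0 \<omega> - \<mu>) \<bullet> a) = 0" by simp
  qed
  have sm: "integrable M (\<lambda>\<omega>. (d k \<omega> \<bullet> a)\<^sup>2)"
    "expectation (\<lambda>\<omega>. (d k \<omega> \<bullet> a)\<^sup>2) = real k * expectation (\<lambda>\<omega>. ((Z 0 \<omega> - \<mu>) \<bullet> a)\<^sup>2)" for k a
    using second_moment_partial_sum[OF X(1)[of a] X(2)[of _ a] X(3)[of a] X(4)[of a], of k] by (simp_all add: partial_sum_centred_inner d_def)
  show "integrable M (\<lambda>\<omega>. (d k \<omega> \<bullet> a)\<^sup>2)"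
    "expectation (\<lambda>\<omega>. (d k \<omega> \<bullet> a)\<^sup>2) = real k * expectation (\<lambda>\<omega>. ((Z 0 \<omega> - \<mu>) \<bullet> a)\<^sup>2)"
    by (rule sm)+
  show "integrable M (\<lambda>\<omega>. (norm (d k \<omega>))\<^sup>2)"
    unfolding norm_sq_vec2 using sm(1) by simp
  show "expectation (\<lambda>\<omega>. (norm (d k \<omega>))\<^sup>2) = real k * total_var M (Z 0)"
    unfolding total_var_def norm_sq_vec2 using sm Z0(3)
    by (simp add: \<mu>_def[symmetric] distrib_left)
  assume \<epsilon>: "\<epsilon> > 0"
  have "\<exists>\<delta>>0. \<forall>k. \<forall>A\<in>events. prob A \<le> \<delta> \<longrightarrow>
      expectation (\<lambda>\<omega>. (d k \<omega> \<bullet> a)\<^sup>2 * indicator A \<omega>) \<le> \<epsilon> / 2 * real k" for a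
  proof (rule partial_sum_square_uniformly_integrable[OF X(1)[of a] X(2)[of _ a] X(3)[of a] X(4)[of a]
        half_gt_zero[OF \<epsilon>]])
    fix \<delta> assume "\<delta> > 0" "\<And>k A. A \<in> events \<Longrightarrow> prob A \<le> \<delta> \<Longrightarrow>
        expectation (\<lambda>\<omega>. (partial_sum (\<lambda>i. (Z i \<omega> - \<mu>) \<bullet> a) k)\<^sup>2 * indicator A \<omega>) \<le> \<epsilon> / 2 * real k"
    then show ?thesis unfolding partial_sum_centred_inner d_def by blast
  qed
  then obtain \<delta> where \<delta>: "\<And>a. \<delta> a > 0" "\<And>a k A. A \<in> events \<Longrightarrow> prob A \<le> \<delta> a \<Longrightarrow>
      expectation (\<lambda>\<omega>. (d k \<omega> \<bullet> a)\<^sup>2 * indicator A \<omega>) \<le> \<epsilon> / 2 * real k"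
    by metis
  let ?e1 = "axis 1 1 :: real^2" and ?e2 = "axis 2 1 :: real^2"
  show "\<exists>\<delta>>0. \<forall>k. \<forall>A\<in>events. prob A \<le> \<delta> \<longrightarrow>
      expectation (\<lambda>\<omega>. (norm (d k \<omega>))\<^sup>2 * indicator A \<omega>) \<le> \<epsilon> * real k"
  proof (intro exI[of _ "min (\<delta> ?e1) (\<delta> ?e2)"] conjI allI ballI impI)
    show "min (\<delta> ?e1) (\<delta> ?e2) > 0" using \<delta>(1) by simp
    fix k A assume A: "A \<in> events" "prob A \<le> min (\<delta> ?e1) (\<delta> ?e2)"
    have int: "integrable M (\<lambda>\<omega>. (d k \<omega> \<bullet> a)\<^sup>2 * indicator A \<omega>)" for a
      using A(1) sm(1) by (intro integrable_real_mult_indicator) auto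
    have "expectation (\<lambda>\<omega>. (norm (d k \<omega>))\<^sup>2 * indicator A \<omega>)
        = expectation (\<lambda>\<omega>. (d k \<omega> \<bullet> ?e1)\<^sup>2 * indicator A \<omega>) + expectation (\<lambda>\<omega>. (d k \<omega> \<bullet> ?e2)\<^sup>2 * indicator A \<omega>)"
      unfolding norm_sq_vec2 distrib_right using int by (intro Bochner_Integration.integral_add) auto
    also have "\<dots> \<le> \<epsilon> / 2 * real k + \<epsilon> / 2 * real k"
      using A by (intro add_mono \<delta>(2)) auto
    finally show "expectation (\<lambda>\<omega>. (norm (d k \<omega>))\<^sup>2 * indicator A \<omega>) \<le> \<epsilon> * real k" by simp
  qed
qed

text \<open>The estimate of \<open>norm_minus_projection_estimate\<close> is integrated with \<open>d = S\<^sub>k - k * \<mu>\<close>. Its first error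
  term is small by the choice of \<open>\<eta>\<close>. Its second one is small for large \<open>k\<close> by uniform integrability,
  since the event of a large fluctuation has probability of order \<open>1 / k\<close> by Chebyshev's inequality.\<close>

lemma (in prob_space) expectation_norm_walk:
  fixes Z :: "nat \<Rightarrow> 'a \<Rightarrow> real^2"
  assumes indep: "indep_vars (\<lambda>_. borel) Z UNIV"
    and ident: "\<And>n. distr M borel (Z n) = distr M borel (Z 0)"
    and sq: "integrable M (\<lambda>\<omega>. (norm (Z 0 \<omega>))\<^sup>2)"
    and drift: "mean M (Z 0) \<noteq> 0"
  shows "(\<lambda>k. expectation (\<lambda>\<omega>. norm (walk Z k \<omega>)) - real k * norm (mean M (Z 0)))
    \<longlonglongrightarrow> perp_var M (Z 0) / (2 * norm (mean M (Z 0)))"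
proof (rule tendstoI)
  fix r :: real assume r: "r > 0"
  define \<mu> where "\<mu> = mean M (Z 0)"
  define m where "m = norm \<mu>"
  define u where "u = mean_dir M (Z 0)"
  define d where "d = (\<lambda>k \<omega>. walk Z k \<omega> - real k *\<^sub>R \<mu>)"
  define V where "V = total_var M (Z 0)"
  have m: "m > 0" using drift by (simp add: m_def \<mu>_def)
  have u: "norm u = 1" "\<mu> = m *\<^sub>R u"
    using m by (simp_all add: u_def mean_dir_def m_def \<mu>_def)
  have rv [measurable]: "Z i \<in> borel_measurable M" for i
    using indep by (auto simp: indep_vars_def)
  have walkm [measurable]: "walk Z k \<in> borel_measurable M" for k
    unfolding walk_def by measurable
  have dm [measurable]: "d k \<in> borel_measurable M" for k
    unfolding d_def by measurable
  have d_eq: "walk Z k \<omega> - real k *\<^sub>R \<mu> = d k \<omega>" for k \<omega>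
    by (simp add: d_def)
  note mom = centred_walk_moments[OF indep ident sq, folded \<mu>_def V_def, unfolded d_eq]
  have V0: "V \<ge> 0" unfolding V_def total_var_def by (intro integral_nonneg_AE) auto
  have Z0: "integrable M (Z 0)" by (rule centred_square_integrable(1)[OF rv sq])
  have Zi: "integrable M (Z i)" "expectation (Z i) = \<mu>" for i
    using ident_expectation[OF ident[of i] rv rv, of "\<lambda>x. x"] Z0 by (simp_all add: \<mu>_def mean_def)
  have walk_int: "integrable M (walk Z k)" "expectation (walk Z k) = real k *\<^sub>R \<mu>" for k
    unfolding walk_def using Zi by (simp_all add: sum_constant_scaleR del: sum_constant)
  \<comment> \<open>Small enough for the first error term to be at most \<open>r / 4\<close>; the denominator \<open>V + 1\<close> also
    covers the case \<open>V = 0\<close>.\<close>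
  define \<eta> where "\<eta> = min (m / 2) (r * m\<^sup>2 / (4 * (V + 1)))"
  have \<eta>: "\<eta> > 0" "\<eta> \<le> m / 2" using m r V0 by (simp add: \<eta>_def, simp only: \<eta>_def min.cobounded1)
  have \<eta>V: "\<eta> / m\<^sup>2 * V \<le> r / 4"
  proof -
    have "\<eta> / m\<^sup>2 * V \<le> (r * m\<^sup>2 / (4 * (V + 1))) / m\<^sup>2 * V"
      using V0 by (intro mult_right_mono divide_right_mono) (auto simp: \<eta>_def)
    also have "\<dots> = r / (4 * (V + 1)) * V" using m by simp
    also have "\<dots> = r / 4 * (V / (V + 1))" using V0 by (simp add: field_simps)
    also have "\<dots> \<le> r / 4 * 1" using r V0 by (intro mult_left_mono) auto
    finally show ?thesis by simp
  qed
  define C where "C = 2 / \<eta> + 1 / (2 * m)"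
  have C: "C > 0" using \<eta> m by (simp add: C_def add_pos_pos)
  obtain \<delta> where \<delta>: "\<delta> > 0" "\<And>k A. A \<in> events \<Longrightarrow> prob A \<le> \<delta> \<Longrightarrow>
      expectation (\<lambda>\<omega>. (norm (d k \<omega>))\<^sup>2 * indicator A \<omega>) \<le> r / (4 * C) * real k"
    using mom(5)[of "r / (4 * C)"] r C by auto
  show "\<forall>\<^sub>F k in sequentially. dist (expectation (\<lambda>\<omega>. norm (walk Z k \<omega>)) - real k * norm (mean M (Z 0)))
      (perp_var M (Z 0) / (2 * norm (mean M (Z 0)))) < r"
    using eventually_ge_at_top[of "nat \<lceil>V / (\<eta>\<^sup>2 * \<delta>)\<rceil>"] eventually_gt_at_top[of 0]
  proof eventually_elim
    case (elim k)
    then have k: "real k > 0" by simp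
    define A where "A = {\<omega> \<in> space M. norm (d k \<omega>) > \<eta> * real k}"
    have A [measurable]: "A \<in> events" unfolding A_def by measurable
    have "prob A \<le> expectation (\<lambda>\<omega>. (norm (d k \<omega>))\<^sup>2 / (\<eta> * real k)\<^sup>2)"
    proof -
      have "indicator A \<omega> \<le> (norm (d k \<omega>))\<^sup>2 / (\<eta> * real k)\<^sup>2" for \<omega>
        using \<eta> k by (auto simp: indicator_def A_def intro!: power_mono)
      then have "expectation (indicator A) \<le> expectation (\<lambda>\<omega>. (norm (d k \<omega>))\<^sup>2 / (\<eta> * real k)\<^sup>2)"
        using mom(3)[of k] by (intro integral_mono) (auto simp: emeasure_eq_measure)
      then show ?thesis by simp
    qed
    also have "\<dots> = real k * V / (\<eta> * real k)\<^sup>2"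
      by (simp only: integral_divide_zero mom(4))
    also have "\<dots> = V / (\<eta>\<^sup>2 * real k)"
      using k \<eta> by (simp add: power2_eq_square)
    also have "\<dots> \<le> \<delta>"
    proof -
      have "V / (\<eta>\<^sup>2 * \<delta>) \<le> real k" using elim by linarith
      then show ?thesis using \<eta> \<delta> k by (simp add: field_simps)
    qed
    finally have UI: "expectation (\<lambda>\<omega>. (norm (d k \<omega>))\<^sup>2 * indicator A \<omega>) \<le> r / (4 * C) * real k"
      using \<delta>(2)[OF A] by simp
    let ?E = "\<lambda>\<omega>. norm (walk Z k \<omega>) - walk Z k \<omega> \<bullet> u - ((norm (d k \<omega>))\<^sup>2 - (d k \<omega> \<bullet> u)\<^sup>2) / (2 * m * real k)"
    have Eint: "integrable M ?E"
      using walk_int(1)[of k] mom(1)[of k u] mom(3)[of k] by auto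
    have Aint: "integrable M (\<lambda>\<omega>. (norm (d k \<omega>))\<^sup>2 * indicator A \<omega>)"
      using mom(3) A by (intro integrable_real_mult_indicator) auto
    have EE: "expectation ?E = (expectation (\<lambda>\<omega>. norm (walk Z k \<omega>)) - real k * m) - perp_var M (Z 0) / (2 * m)"
    proof -
      have "expectation (\<lambda>\<omega>. walk Z k \<omega> \<bullet> u) = (real k *\<^sub>R \<mu>) \<bullet> u"
        using walk_int[of k] by (subst integral_inner_left) auto
      also have "\<dots> = real k * m" using u by (simp add: dot_square_norm)
      finally have 1: "expectation (\<lambda>\<omega>. walk Z k \<omega> \<bullet> u) = real k * m" .
      have 2: "expectation (\<lambda>\<omega>. ((norm (d k \<omega>))\<^sup>2 - (d k \<omega> \<bullet> u)\<^sup>2) / (2 * m * real k)) = perp_var M (Z 0) / (2 * m)"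
        using mom(1)[of k u] mom(3)[of k] k m
        by (simp add: mom(2,4)) (simp add: perp_var_def par_var_def V_def \<mu>_def u_def field_simps)
      show ?thesis using walk_int(1)[of k] mom(1)[of k u] mom(3)[of k] 1 2
        by (subst Bochner_Integration.integral_diff; simp)+
    qed
    have "\<bar>?E \<omega>\<bar> \<le> \<eta> / m\<^sup>2 * ((norm (d k \<omega>))\<^sup>2 / real k) + C * ((norm (d k \<omega>))\<^sup>2 * indicator A \<omega> / real k)"
      if "\<omega> \<in> space M" for \<omega>
    proof -
      have "walk Z k \<omega> = (real k * m) *\<^sub>R u + d k \<omega>" by (simp add: d_def u(2))
      from norm_minus_projection_estimate[OF u(1) m k \<eta> this] show ?thesis
        using that by (simp add: C_def A_def indicator_def of_bool_def)
    qed
    then have "expectation (\<lambda>\<omega>. \<bar>?E \<omega>\<bar>)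
        \<le> expectation (\<lambda>\<omega>. \<eta> / m\<^sup>2 * ((norm (d k \<omega>))\<^sup>2 / real k) + C * ((norm (d k \<omega>))\<^sup>2 * indicator A \<omega> / real k))"
      using Eint mom(3)[of k] Aint by (intro integral_mono integrable_abs) auto
    also have "\<dots> = \<eta> / m\<^sup>2 * (expectation (\<lambda>\<omega>. (norm (d k \<omega>))\<^sup>2) / real k)
        + C * (expectation (\<lambda>\<omega>. (norm (d k \<omega>))\<^sup>2 * indicator A \<omega>) / real k)"
      using mom(3)[of k] Aint
      by (simp only: Bochner_Integration.integral_add integrable_mult_right integrable_divide
          integral_mult_right_zero integral_divide_zero)
    also have "\<dots> \<le> \<eta> / m\<^sup>2 * V + C * (r / (4 * C))"
      using UI k C \<eta>(1) by (intro add_mono mult_left_mono) (auto simp: mom(4) pos_divide_le_eq)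
    also have "C * (r / (4 * C)) = r / 4" using C by simp
    also have "\<eta> / m\<^sup>2 * V + r / 4 < r" using \<eta>V r by linarith
    finally have "\<bar>expectation ?E\<bar> < r"
      using integral_abs_bound[of M ?E] by linarith
    then show ?case unfolding EE by (simp add: dist_real_def m_def \<mu>_def)
  qed
qed

section \<open>The logarithmic term\<close>

text \<open>A weighted Cesaro mean: the weights \<open>1 / k\<close> have total mass \<open>harm n\<close>, which is asymptotic to
  \<open>ln n\<close>.\<close>

lemma log_average_tendsto:
  fixes a :: "nat \<Rightarrow> real"
  assumes a: "a \<longlonglongrightarrow> l"
  shows "(\<lambda>n. (\<Sum>k=1..n. a k / real k) / ln (real n)) \<longlonglongrightarrow> l"
proof -
  have ln_inf: "filterlim (\<lambda>n. ln (real n)) at_top sequentially"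
    by (intro filterlim_compose[OF ln_at_top] filterlim_real_sequentially)
  have ln_pos: "\<forall>\<^sub>F n in sequentially. ln (real n) > 0"
    using eventually_gt_at_top[of 1] by eventually_elim simp
  have "(\<lambda>n. (harm n - ln (real n)) / ln (real n)) \<longlonglongrightarrow> 0"
    by (intro tendsto_divide_0[OF euler_mascheroni_LIMSEQ] filterlim_at_top_imp_at_infinity ln_inf)
  then have "(\<lambda>n. (harm n - ln (real n)) / ln (real n) + 1) \<longlonglongrightarrow> 0 + 1"
    by (intro tendsto_intros)
  moreover have "\<forall>\<^sub>F n in sequentially. (harm n - ln (real n)) / ln (real n) + 1 = harm n / ln (real n)"
    using ln_pos by eventually_elim (simp add: field_simps)
  ultimately have harm: "(\<lambda>n. harm n / ln (real n)) \<longlonglongrightarrow> (1 :: real)"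
    using Lim_transform_eventually by force
  define b where "b = (\<lambda>k. a k - l)"
  have b: "b \<longlonglongrightarrow> 0" using LIM_zero[OF a] by (simp add: b_def)
  have "(\<lambda>n. (\<Sum>k=1..n. b k / real k) / ln (real n)) \<longlonglongrightarrow> 0"
  proof (rule tendstoI)
    fix r :: real assume r: "r > 0"
    then obtain N where N: "\<And>k. k \<ge> N \<Longrightarrow> \<bar>b k\<bar> < r / 2"
      using LIMSEQ_D[OF b, of "r / 2"] by auto
    define C where "C = (\<Sum>k\<le>N. \<bar>b k\<bar>)"
    have bound: "\<bar>\<Sum>k=1..n. b k / real k\<bar> \<le> C + r / 2 * harm n" for n
    proof -
      have "\<bar>\<Sum>k=1..n. b k / real k\<bar> \<le> (\<Sum>k=1..n. \<bar>b k / real k\<bar>)" by (rule sum_abs)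
      also have "\<dots> \<le> (\<Sum>k=1..n. (if k \<le> N then \<bar>b k\<bar> else 0) + r / 2 * inverse (real k))"
      proof (rule sum_mono)
        fix k assume k: "k \<in> {1..n}"
        show "\<bar>b k / real k\<bar> \<le> (if k \<le> N then \<bar>b k\<bar> else 0) + r / 2 * inverse (real k)"
        proof (cases "k \<le> N")
          case True
          have "\<bar>b k\<bar> / real k \<le> \<bar>b k\<bar> / 1" using k by (intro divide_left_mono) auto
          then show ?thesis using True r by (simp add: add_increasing2)
        next
          case False
          then have "\<bar>b k\<bar> / real k \<le> (r / 2) / real k" using N[of k] by (intro divide_right_mono) auto
          then show ?thesis using False by (simp add: inverse_eq_divide)
        qed
      qed
      also have "\<dots> = (\<Sum>k=1..n. if k \<le> N then \<bar>b k\<bar> else 0) + r / 2 * harm n"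
        by (simp add: sum.distrib harm_def sum_distrib_left)
      also have "(\<Sum>k=1..n. if k \<le> N then \<bar>b k\<bar> else 0) = (\<Sum>k\<in>{1..n} \<inter> {k. k \<le> N}. \<bar>b k\<bar>)"
        by (simp add: sum.If_cases)
      also have "\<dots> \<le> C" unfolding C_def by (intro sum_mono2) auto
      finally show ?thesis by simp
    qed
    have "(\<lambda>n. C / ln (real n) + r / 2 * (harm n / ln (real n))) \<longlonglongrightarrow> 0 + r / 2 * 1"
      by (intro tendsto_intros harm tendsto_divide_0[OF tendsto_const]
          filterlim_at_top_imp_at_infinity ln_inf)
    then have "\<forall>\<^sub>F n in sequentially. C / ln (real n) + r / 2 * (harm n / ln (real n)) < r"
      by (rule order_tendstoD(2)) (use r in simp)
    then show "\<forall>\<^sub>F n in sequentially. dist ((\<Sum>k=1..n. b k / real k) / ln (real n)) 0 < r"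
      using ln_pos
    proof eventually_elim
      case (elim n)
      have "\<bar>(\<Sum>k=1..n. b k / real k) / ln (real n)\<bar> \<le> (C + r / 2 * harm n) / ln (real n)"
        using bound[of n] elim by (simp add: divide_right_mono)
      then show ?case using elim by (simp add: add_divide_distrib)
    qed
  qed
  then have "(\<lambda>n. (\<Sum>k=1..n. b k / real k) / ln (real n) + l * (harm n / ln (real n))) \<longlonglongrightarrow> 0 + l * 1"
    by (intro tendsto_intros harm)
  moreover have "(\<Sum>k=1..n. b k / real k) = (\<Sum>k=1..n. a k / real k) - l * harm n" for n
    by (simp add: b_def harm_def sum_distrib_left diff_divide_distrib sum_subtractf inverse_eq_divide)
  ultimately show ?thesis by (simp add: diff_divide_distrib)
qed

theorem theorem1p8:
  fixes M :: "'a measure" and Z :: "nat \<Rightarrow> 'a \<Rightarrow> real^2"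
  assumes "prob_space M"
    and indep: "prob_space.indep_vars M (\<lambda>_. borel) Z UNIV"
    and ident: "\<And>n. distr M borel (Z n) = distr M borel (Z 0)"
    and second_moment: "integrable M (\<lambda>\<omega>. (norm (Z 0 \<omega>))\<^sup>2)"
    and drift: "mean M (Z 0) \<noteq> 0"
  shows "\<exists>\<epsilon> :: nat \<Rightarrow> real. \<epsilon> \<in> o(\<lambda>_. 1) \<and>
    (\<forall>\<^sub>F n in sequentially.
      (LINT \<omega>|M. hull_perimeter Z n \<omega>) =
        2 * norm (mean M (Z 0)) * real n
        + (perp_var M (Z 0) / norm (mean M (Z 0)) + \<epsilon> n) * ln (real n))"
proof -
  interpret prob_space M by fact
  have rv: "Z i \<in> borel_measurable M" for i
    using indep by (auto simp: indep_vars_def)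
  have Z0: "integrable M (Z 0)"
    by (rule centred_square_integrable(1)[OF rv second_moment])
  have int: "integrable M (Z i)" for i
    using ident_expectation(2)[OF ident[of i] rv rv, of "\<lambda>x. x"] Z0 by simp
  define m where "m = norm (mean M (Z 0))"
  define \<beta> where "\<beta> = perp_var M (Z 0) / (2 * m)"
  define a where "a = (\<lambda>k. expectation (\<lambda>\<omega>. norm (walk Z k \<omega>)) - real k * m)"
  define s where "s = (\<lambda>n. \<Sum>k=1..n. a k / real k)"
  define \<epsilon> where "\<epsilon> = (\<lambda>n. 2 * (s n / ln (real n)) - 2 * \<beta>)"
  have "a \<longlonglongrightarrow> \<beta>"
    using expectation_norm_walk[OF indep ident second_moment drift] by (simp add: a_def \<beta>_def m_def)
  then have "(\<lambda>n. s n / ln (real n)) \<longlonglongrightarrow> \<beta>"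
    unfolding s_def by (rule log_average_tendsto)
  then have "\<epsilon> \<longlonglongrightarrow> 2 * \<beta> - 2 * \<beta>"
    unfolding \<epsilon>_def by (intro tendsto_intros)
  then have "\<epsilon> \<in> o(\<lambda>_. 1)"
    by (intro smalloI_tendsto) auto
  moreover have "\<forall>\<^sub>F n in sequentially. expectation (hull_perimeter Z n)
      = 2 * m * real n + (perp_var M (Z 0) / m + \<epsilon> n) * ln (real n)"
    using eventually_gt_at_top[of 1]
  proof eventually_elim
    case (elim n)
    then have ln: "ln (real n) \<noteq> 0" by simp
    have "expectation (hull_perimeter Z n) = (\<Sum>k=1..n. 2 * m + 2 * (a k / real k))"
      unfolding expectation_hull_perimeter[OF indep ident int]
      by (intro sum.cong) (auto simp: a_def field_simps)
    also have "\<dots> = 2 * m * real n + 2 * s n"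
      by (simp add: sum.distrib s_def sum_distrib_left)
    also have "2 * s n = (2 * \<beta> + \<epsilon> n) * ln (real n)"
      using ln by (simp add: \<epsilon>_def)
    finally show ?case by (simp add: \<beta>_def)
  qed
  ultimately show ?thesis
    unfolding m_def by blast
qed

end
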